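(* Let $q$ be a large prime and $y>2$ real. For each $1\le j\le\pi(y)$ let $I_j\subset(0,1)$ be an open interval of length $\delta_j>0$ and let $$N=\left|\left\{\chi\bmod q:\ \left\{\frac{\arg\chi(p_j)}{2\pi}\right\}\in I_j\text{ for all }1\le j\le\pi(y)\right\}\right|.$$ Then $N\sim\phi(q)\prod_{j\le\pi(y)}\delta_j$ as $q\to\infty$, uniformly for $y\le\sqrt{\log q}/(\log_2q)^2$ and $\delta_j>(\log_2q)^{-5/3}$ for all $j$.
   Context: The set ranges over all Dirichlet characters mod $q$. $p_j$ is the $j$-th smallest prime, $\pi(y)$ the number of primes up to $y$, $\{\cdot\}$ the fractional part (which makes the choice of branch of $\arg$ irrelevant), $\phi$ Euler's function, $\log_2=\log\log$. *)

theory Defs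
  imports Complex_Main "HOL-Library.Infinite_Set" "HOL-Number_Theory.Totient"
begin

(* Multiplicativity and X 1 \<noteq> 0 (n = 1 in the last clause) give X 1 = 1. *)
definition dirichlet_character :: "nat \<Rightarrow> (int \<Rightarrow> complex) \<Rightarrow> bool" where
  "dirichlet_character q X \<longleftrightarrow>
     (\<forall>m n. X (m * n) = X m * X n) \<and>
     (\<forall>n. X (n + int q) = X n) \<and>
     (\<forall>n. X n \<noteq> 0 \<longleftrightarrow> coprime n (int q))"

definition prime_count :: "real \<Rightarrow> nat" where
  "prime_count y = card {p :: nat. prime p \<and> real p \<le> y}"

(* 1-based: nth_prime 1 = 2; library enumeration starts at 0. Junk value nth_prime 0 = 2. *)
definition nth_prime :: "nat \<Rightarrow> nat" where
  "nth_prime j = enumerate {p :: nat. prime p} (j - 1)"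

definition open_interval_of_length :: "real set \<Rightarrow> real \<Rightarrow> bool" where
  "open_interval_of_length J \<delta> \<longleftrightarrow> \<delta> > 0 \<and> (\<exists>a. J = {a<..<a + \<delta>})"

(* When q \<le> y, some X (nth_prime j) is 0 and the library value Arg 0 = 0 is used, so that
   such a prime lies in no I j contained in (0,1). The range of y in the theorem forces y < q for
   all large q. *)
definition character_count :: "nat \<Rightarrow> real \<Rightarrow> (nat \<Rightarrow> real set) \<Rightarrow> nat" where
  "character_count q y I =
     card {X. dirichlet_character q X \<and>
              (\<forall>j\<in>{1..prime_count y}. frac (Arg (X (int (nth_prime j))) / (2 * pi)) \<in> I j)}"

end

theory Submission
  imports Defs "HOL-Analysis.Analysis" "HOL-Number_Theory.Number_Theory" "HOL-Real_Asymp.Real_Asymp"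
begin

text \<open>Fix a nonnegative trigonometric polynomial of degree \<open>d\<close> and mean 1 (a power of the Fejer kernel)
  whose values at distance at least \<open>\<eta>\<close> from \<open>0\<close> are at most a tiny \<open>\<kappa>\<close>. Smoothing with it the
  indicators of the slightly enlarged (shrunk) intervals \<open>I j\<close> gives trigonometric polynomials of
  degree \<open>d\<close> which, up to \<open>\<kappa>\<close>, are majorants (minorants) of the indicators of the \<open>I j\<close>. Expanding
  a product of such polynomials in the values \<open>\<chi>(p\<^sub>j)\<close> produces terms \<open>\<chi>(A) cnj (\<chi>(B))\<close> with
  \<open>A, B \<le> (\<Prod>j. p\<^sub>j ^ d) < q\<close>. Averaged over \<open>\<chi>\<close> these vanish unless \<open>A = B\<close>, hence by unique
  factorisation only the product of the constant terms survives, exactly as if the \<open>\<chi>(p\<^sub>j)\<close> were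
  independent and uniform on the circle.

  With \<open>L = ln q\<close> and \<open>l = ln L\<close>, taking the \<open>2r\<close>-th power of a Dirichlet kernel of length
  \<open>H \<approx> sqrt L\<close> with \<open>r \<approx> l\<close> allows \<open>\<eta> = 2 / H\<close> and \<open>\<kappa> \<le> (l + 1) L powr (-3/2)\<close>, so that the
  relative error is of order \<open>\<pi>(y) \<eta> / min \<delta>\<^sub>j\<close>, that is at most \<open>12 l powr (-1/3)\<close>.\<close>

section \<open>Dirichlet characters of prime modulus\<close>

lemma dirichlet_character_mult: "dirichlet_character q X \<Longrightarrow> X (m * n) = X m * X n"
  by (simp add: dirichlet_character_def)

lemma dirichlet_character_nonzero_iff:
  "dirichlet_character q X \<Longrightarrow> X n \<noteq> 0 \<longleftrightarrow> coprime n (int q)"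
  by (simp add: dirichlet_character_def)

lemma dirichlet_character_1:
  assumes "dirichlet_character q X"
  shows "X 1 = 1"
proof -
  have "X 1 * X 1 = X 1" "X 1 \<noteq> 0"
    using assms dirichlet_character_mult[OF assms, of 1 1] by (auto simp: dirichlet_character_def)
  thus ?thesis by simp
qed

lemma dirichlet_character_power:
  assumes "dirichlet_character q X"
  shows "X (a ^ i) = X a ^ i"
  by (induction i) (simp_all add: dirichlet_character_1[OF assms] dirichlet_character_mult[OF assms])

lemma dirichlet_character_prod:
  assumes "dirichlet_character q X"
  shows "X (\<Prod>j\<in>J. f j) = (\<Prod>j\<in>J. X (f j))"
  by (induction J rule: infinite_finite_induct)
     (simp_all add: dirichlet_character_1[OF assms] dirichlet_character_mult[OF assms])

lemma dirichlet_character_cong: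
  assumes "dirichlet_character q X" "[a = b] (mod int q)"
  shows "X a = X b"
proof -
  have per: "X (n + int q) = X n" for n
    using assms(1) by (simp add: dirichlet_character_def)
  have per': "X (n + int q * int k) = X n" for n k
  proof (induction k)
    case (Suc k)
    have "X (n + int q * int (Suc k)) = X ((n + int q * int k) + int q)"
      by (simp add: algebra_simps)
    with Suc show ?case by (simp add: per)
  qed simp
  \<comment> \<open>The iterated periodicity \<open>per'\<close> moves forward only, by natural
    multiples of \<open>q\<close>. Shifting both \<open>a\<close> and \<open>b\<close> forward to a
    common point avoids a negative multiple.\<close>
  have "\<exists>k1 k2. b + int k1 * int q = a + int k2 * int q"
  proof -
    from assms(2) obtain t where t: "b = a + int q * t"
      by (meson cong_iff_lin)
    show ?thesis
    proof (cases "t \<ge> 0")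
      case True
      with t have "b + int 0 * int q = a + int (nat t) * int q" by (simp add: algebra_simps)
      thus ?thesis by blast
    next
      case False
      with t have "b + int (nat (-t)) * int q = a + int 0 * int q" by (simp add: algebra_simps)
      thus ?thesis by blast
    qed
  qed
  then obtain k1 k2 where k: "b + int k1 * int q = a + int k2 * int q" by blast
  have "X a = X (a + int k2 * int q)" using per'[of a k2] by (simp add: mult.commute)
  also have "\<dots> = X b" using per'[of b k1] by (simp add: mult.commute flip: k)
  finally show ?thesis .
qed

section \<open>Roots of unity\<close>

lemma cis_power_root_unity_cong:
  assumes "m > 0" "[i = j] (mod m)"
  shows "cis (2 * pi / real m) ^ i = cis (2 * pi / real m) ^ j"
proof -
  have w: "cis (2 * pi / real m) ^ m = 1"
    using assms(1) by (subst Complex.DeMoivre) simp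
  have "cis (2 * pi / real m) ^ i = cis (2 * pi / real m) ^ (i mod m)" for i
  proof -
    have "cis (2 * pi / real m) ^ i = cis (2 * pi / real m) ^ (m * (i div m) + i mod m)" by simp
    also have "\<dots> = cis (2 * pi / real m) ^ (i mod m)" by (simp only: power_add power_mult w) simp
    finally show ?thesis .
  qed
  from this[of i] this[of j] show ?thesis using assms(2) by (simp add: unique_euclidean_semiring_class.cong_def)
qed

lemma cis_power_root_unity_eq_iff:
  assumes "i < m" "j < m"
  shows "cis (2 * pi / real m) ^ i = cis (2 * pi / real m) ^ j \<longleftrightarrow> i = j"
proof -
  have "m > 0" using assms by simp
  hence "inj_on (\<lambda>k. cis (2 * pi * real k / real m)) {..<m}"
    using bij_betw_imp_inj_on[OF Complex.bij_betw_roots_unity] by blast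
  hence "cis (2 * pi * real i / real m) = cis (2 * pi * real j / real m) \<longleftrightarrow> i = j"
    using inj_on_eq_iff[of _ "{..<m}" i j] assms by simp
  thus ?thesis by (simp add: Complex.DeMoivre mult_ac)
qed

text \<open>The sum is geometric with ratio \<open>z = w ^ i * cnj (w ^ j)\<close>, an
  \<open>m\<close>-th root of unity that equals 1 only for \<open>i = j\<close>. It serves twice:
  for the orthogonality of characters and for the exact mean of the kernel over equally spaced
  shifts.\<close>

lemma sum_root_unity_orthogonal:
  assumes "i < m" "j < m"
  defines "w \<equiv> cis (2 * pi / real m)"
  shows "(\<Sum>k<m. w ^ (k * i) * cnj (w ^ (k * j))) = (if i = j then of_nat m else 0)"
proof -
  define z where "z = w ^ i * cnj (w ^ j)"
  have wc: "w ^ j * cnj (w ^ j) = 1"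
    unfolding w_def Complex.DeMoivre cis_cnj cis_mult by simp
  have wm: "w ^ m = 1" using assms(1) unfolding w_def by (subst Complex.DeMoivre) simp
  have "z ^ m = (w ^ m) ^ i * cnj ((w ^ m) ^ j)"
    by (simp add: z_def power_mult_distrib flip: power_mult) (simp add: mult.commute)
  hence zm: "z ^ m = 1" by (simp add: wm)
  have sum: "(\<Sum>k<m. w ^ (k * i) * cnj (w ^ (k * j))) = (\<Sum>k<m. z ^ k)"
    by (simp add: z_def power_mult_distrib flip: power_mult) (simp add: mult.commute)
  show ?thesis
  proof (cases "i = j")
    case True
    hence "z = 1" using wc by (simp add: z_def)
    thus ?thesis unfolding sum using True by simp
  next
    case False
    have "z \<noteq> 1"
    proof
      assume "z = 1"
      hence "w ^ i * (w ^ j * cnj (w ^ j)) = w ^ j" by (simp add: z_def mult_ac)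
      hence "w ^ i = w ^ j" by (simp only: wc mult_1_right)
      with cis_power_root_unity_eq_iff[OF assms(1,2)] False show False by (simp add: w_def)
    qed
    thus ?thesis unfolding sum using False zm by (simp add: sum_gp_strict)
  qed
qed

text \<open>The multiplicative group mod \<open>q\<close> is cyclic, and \<open>ind\<close> is the
  discrete logarithm to the base of a primitive root \<open>g\<close>. A character is determined by
  its value at \<open>g\<close>, which can be any \<open>(q - 1)\<close>-th root of unity; the index
  \<open>k\<close> names that root.\<close>

lemma dirichlet_characters_of_prime:
  assumes q: "prime q"
  obtains ind :: "int \<Rightarrow> nat" where
    "\<And>a. coprime a (int q) \<Longrightarrow> ind a < q - 1"
    "\<And>a b. coprime a (int q) \<Longrightarrow> coprime b (int q) \<Longrightarrow> ind a = ind b \<Longrightarrow> [a = b] (mod int q)"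
    "bij_betw (\<lambda>k n. if coprime n (int q) then cis (2 * pi / real (q - 1)) ^ (k * ind n) else 0)
       {..<q - 1} {X. dirichlet_character q X}"
proof -
  define m where "m = q - 1"
  have q1: "q > 1" using q prime_gt_1_nat by blast
  have m: "m > 0" using q1 by (simp add: m_def)
  obtain g where g: "residue_primroot q g"
    using prime_primitive_root_exists[of q] q q1 by blast
  have tot: "totient q = m" using q by (simp add: totient_prime m_def)
  have ordg: "ord q g = m" and copg: "coprime q g"
    using g tot by (auto simp: residue_primroot_def)
  have bij: "bij_betw (\<lambda>i. g ^ i mod q) {..<m} (totatives q)"
    using residue_primroot_is_generator[OF q1 g] tot by simp
  have "\<exists>i<m. [a = int g ^ i] (mod int q)" if "coprime a (int q)" for a
  proof -
    have "nat (a mod int q) \<in> totatives q"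
    proof -
      have "coprime (a mod int q) (int q)" using that q1 by simp
      hence c: "coprime (nat (a mod int q)) q"
        using q1 by (simp flip: coprime_int_iff)
      have "nat (a mod int q) \<noteq> 0"
        using c q1 by (metis coprime_0_left_iff nat_dvd_1_iff_1 less_numeral_extra(4))
      moreover have "nat (a mod int q) < q" using q1 by (simp add: nat_less_iff)
      ultimately show ?thesis using c by (auto simp: totatives_def)
    qed
    then obtain i where i: "i < m" "g ^ i mod q = nat (a mod int q)"
      using bij unfolding bij_betw_def by (metis (no_types, lifting) imageE lessThan_iff)
    have "int (g ^ i mod q) = a mod int q" using i q1 by simp
    hence "[a = int g ^ i] (mod int q)" unfolding unique_euclidean_semiring_class.cong_def by (metis of_nat_mod of_nat_power)
    with i show ?thesis by blast
  qed
  then obtain ind where ind: "ind a < m" "[a = int g ^ ind a] (mod int q)"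
    if "coprime a (int q)" for a
    by metis
  \<comment> \<open>Exponents of \<open>g\<close> are determined modulo its order \<open>m\<close>.
    This turns multiplicativity and periodicity of \<open>X k\<close> into congruences between
    discrete logarithms.\<close>
  have pow: "[i = j] (mod m)" if "[int g ^ i = int g ^ j] (mod int q)" for i j
    using that order_divides_expdiff[OF copg, of i j] ordg by (simp flip: cong_int_iff)
  have gm: "[int g ^ m = 1] (mod int q)"
    using ord_works[of g q] ordg by (metis cong_int_iff of_nat_1 of_nat_power)
  have copg': "coprime (int g) (int q)" using copg by (simp add: coprime_commute)
  define w where "w = cis (2 * pi / real m)"
  define X where "X = (\<lambda>k n. if coprime n (int q) then w ^ (k * ind n) else 0)"
  have wcong: "w ^ i = w ^ j" if "[i = j] (mod m)" for i j
    using cis_power_root_unity_cong[OF m that] by (simp add: w_def)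
  have w0: "w \<noteq> 0" by (simp add: w_def)
  \<comment> \<open>The value at \<open>g\<close> recovers \<open>k\<close>, hence distinct
    \<open>k < m\<close> give distinct characters.\<close>
  have Xg: "X k (int g) = w ^ k" for k
  proof -
    have "[ind (int g) = 1] (mod m)"
      using ind(2)[OF copg'] by (intro pow) (simp add: cong_sym)
    hence "[k * ind (int g) = k * 1] (mod m)" by (rule cong_scalar_left)
    thus ?thesis using wcong copg' by (simp add: X_def)
  qed
  have Xchar: "dirichlet_character q (X k)" for k
  proof -
    have "X k (a * b) = X k a * X k b" for a b
    proof (cases "coprime a (int q) \<and> coprime b (int q)")
      case True
      hence ab: "coprime (a * b) (int q)" by simp
      have "[int g ^ ind (a * b) = int g ^ (ind a + ind b)] (mod int q)"
        using ind(2)[OF ab] True ind(2)[of a] ind(2)[of b]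
        by (metis cong_mult cong_sym cong_trans power_add)
      hence "[k * ind (a * b) = k * (ind a + ind b)] (mod m)"
        by (intro cong_scalar_left pow)
      thus ?thesis using True wcong by (simp add: X_def distrib_left power_add)
    next
      case False
      thus ?thesis by (auto simp: X_def)
    qed
    moreover have "X k (n + int q) = X k n" for n
    proof (cases "coprime n (int q)")
      case True
      have c: "coprime (n + int q) (int q)" using True
        by (simp add: coprime_iff_gcd_eq_1)
      have "[int g ^ ind (n + int q) = int g ^ ind n] (mod int q)"
        using ind(2)[OF c] ind(2)[OF True] by (simp add: unique_euclidean_semiring_class.cong_def)
      hence "[k * ind (n + int q) = k * ind n] (mod m)"
        by (intro cong_scalar_left pow)
      thus ?thesis using True c wcong by (simp add: X_def)
    next
      case False
      hence "\<not> coprime (n + int q) (int q)"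
        by (simp add: coprime_iff_gcd_eq_1)
      with False show ?thesis by (simp add: X_def)
    qed
    ultimately show ?thesis
      using w0 by (auto simp: dirichlet_character_def X_def)
  qed
  have "bij_betw X {..<m} {X. dirichlet_character q X}"
    unfolding bij_betw_def
  proof
    show "inj_on X {..<m}"
    proof
      fix i j assume "i \<in> {..<m}" "j \<in> {..<m}" "X i = X j"
      thus "i = j"
        using Xg[of i] Xg[of j] cis_power_root_unity_eq_iff[of i m j] by (simp add: w_def)
    qed
    show "X ` {..<m} = {X. dirichlet_character q X}"
    proof (intro equalityI subsetI)
      fix Y assume "Y \<in> {X. dirichlet_character q X}"
      hence Y: "dirichlet_character q Y" by simp
      \<comment> \<open>Surjectivity: since \<open>g ^ m\<close> is 1 mod \<open>q\<close>, the
        value \<open>Y (int g)\<close> is some \<open>w ^ k\<close>, and every coprime residue is a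
        power of \<open>g\<close>.\<close>
      have "Y (int g) ^ m = 1"
        using dirichlet_character_cong[OF Y gm] dirichlet_character_1[OF Y]
        by (simp add: dirichlet_character_power[OF Y])
      hence "Y (int g) \<in> (\<lambda>k. cis (2 * pi * real k / real m)) ` {..<m}"
        unfolding bij_betw_imp_surj_on[OF Complex.bij_betw_roots_unity[OF m]] by simp
      then obtain k where k: "k < m" "Y (int g) = cis (2 * pi * real k / real m)"
        by auto
      hence Yg: "Y (int g) = w ^ k" unfolding w_def Complex.DeMoivre by (simp add: mult_ac)
      have "Y = X k"
      proof
        fix n
        show "Y n = X k n"
        proof (cases "coprime n (int q)")
          case True
          have "Y n = Y (int g) ^ ind n"
            using dirichlet_character_cong[OF Y ind(2)[OF True]]
            by (simp add: dirichlet_character_power[OF Y])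
          thus ?thesis using True Yg by (simp add: X_def power_mult)
        next
          case False
          thus ?thesis using dirichlet_character_nonzero_iff[OF Y] by (auto simp: X_def)
        qed
      qed
      thus "Y \<in> X ` {..<m}" using k by blast
    qed (use Xchar in auto)
  qed
  moreover have "[a = b] (mod int q)"
    if "coprime a (int q)" "coprime b (int q)" "ind a = ind b" for a b
    using ind(2)[OF that(1)] ind(2)[OF that(2)] that(3) by (metis cong_sym cong_trans)
  ultimately show ?thesis
    using ind(1) unfolding X_def w_def m_def by (intro that[of ind])
qed

lemma finite_dirichlet_characters:
  assumes "prime q"
  shows "finite {X. dirichlet_character q X}"
proof -
  obtain ind :: "int \<Rightarrow> nat" where
    "\<And>a. coprime a (int q) \<Longrightarrow> ind a < q - 1"
    "\<And>a b. coprime a (int q) \<Longrightarrow> coprime b (int q) \<Longrightarrow> ind a = ind b \<Longrightarrow> [a = b] (mod int q)"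
    and bij: "bij_betw (\<lambda>k n. if coprime n (int q) then cis (2 * pi / real (q - 1)) ^ (k * ind n) else 0)
       {..<q - 1} {X. dirichlet_character q X}"
    using dirichlet_characters_of_prime[OF assms] by blast
  show ?thesis using bij_betw_finite[OF bij] by simp
qed

text \<open>Listing the characters by \<open>k\<close> turns the sum into one over roots of unity
  with exponents \<open>ind a\<close> and \<open>ind b\<close>.\<close>

lemma dirichlet_character_orthogonality:
  assumes q: "prime q" and a: "coprime a (int q)" and b: "coprime b (int q)"
  shows "(\<Sum>X | dirichlet_character q X. X a * cnj (X b)) =
    (if [a = b] (mod int q) then of_nat (q - 1) else 0)"
proof -
  obtain ind :: "int \<Rightarrow> nat" where ind:
    "\<And>a. coprime a (int q) \<Longrightarrow> ind a < q - 1"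
    "\<And>a b. coprime a (int q) \<Longrightarrow> coprime b (int q) \<Longrightarrow> ind a = ind b \<Longrightarrow> [a = b] (mod int q)"
    and bij: "bij_betw (\<lambda>k n. if coprime n (int q) then cis (2 * pi / real (q - 1)) ^ (k * ind n) else 0)
       {..<q - 1} {X. dirichlet_character q X}"
    using dirichlet_characters_of_prime[OF q] by blast
  show ?thesis
  proof (cases "[a = b] (mod int q)")
    case True
    \<comment> \<open>The properties at hand let \<open>ind\<close> separate residue classes but do
      not say that it is constant on them. So \<open>b\<close> is first replaced by
      \<open>a\<close>, using the periodicity of the characters.\<close>
    have "X a * cnj (X b) = X a * cnj (X a)" if "dirichlet_character q X" for X
      using dirichlet_character_cong[OF that True] by simp
    hence "(\<Sum>X | dirichlet_character q X. X a * cnj (X b)) =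
      (\<Sum>X | dirichlet_character q X. X a * cnj (X a))"
      by (intro sum.cong) auto
    also have "\<dots> = (\<Sum>k<q - 1. cis (2 * pi / real (q - 1)) ^ (k * ind a) *
        cnj (cis (2 * pi / real (q - 1)) ^ (k * ind a)))"
      using a by (subst sum.reindex_bij_betw[OF bij, symmetric]) simp
    also have "\<dots> = of_nat (q - 1)"
      using sum_root_unity_orthogonal[OF ind(1)[OF a] ind(1)[OF a]] by simp
    finally show ?thesis using True by simp
  next
    case False
    have "(\<Sum>X | dirichlet_character q X. X a * cnj (X b)) =
      (\<Sum>k<q - 1. cis (2 * pi / real (q - 1)) ^ (k * ind a) *
        cnj (cis (2 * pi / real (q - 1)) ^ (k * ind b)))"
      using a b by (subst sum.reindex_bij_betw[OF bij, symmetric]) simp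
    also have "\<dots> = 0"
      using sum_root_unity_orthogonal[OF ind(1)[OF a] ind(1)[OF b]] False ind(2)[OF a b] by auto
    finally show ?thesis using False by simp
  qed
qed

lemma norm_dirichlet_character:
  assumes q: "prime q" and X: "dirichlet_character q X" and a: "coprime a (int q)"
  shows "norm (X a) = 1"
proof -
  obtain ind :: "int \<Rightarrow> nat" where
    "\<And>a. coprime a (int q) \<Longrightarrow> ind a < q - 1"
    "\<And>a b. coprime a (int q) \<Longrightarrow> coprime b (int q) \<Longrightarrow> ind a = ind b \<Longrightarrow> [a = b] (mod int q)"
    and bij: "bij_betw (\<lambda>k n. if coprime n (int q) then cis (2 * pi / real (q - 1)) ^ (k * ind n) else 0)
       {..<q - 1} {X. dirichlet_character q X}"
    using dirichlet_characters_of_prime[OF q] by blast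
  obtain k where "X = (\<lambda>n. if coprime n (int q)
      then cis (2 * pi / real (q - 1)) ^ (k * ind n) else 0)"
    using bij_betw_imp_surj_on[OF bij] X by blast
  hence "X a = cis (2 * pi / real (q - 1)) ^ (k * ind a)"
    using a by simp
  thus ?thesis by (simp add: norm_power)
qed

section \<open>Smoothed indicators and their independence\<close>

text \<open>At \<open>z = cis (2 * pi * \<theta>)\<close> this is the convolution of the squared modulus of the polynomial with
  coefficients \<open>a\<close> and the measure of mass \<open>1 / N\<close> at each point \<open>s / N\<close>, \<open>s \<in> A\<close>. For \<open>d < N\<close>
  the discretisation loses nothing: the sum over a full period is exactly the mean of the kernel.\<close>

definition smoothed :: "(nat \<Rightarrow> complex) \<Rightarrow> nat \<Rightarrow> nat \<Rightarrow> int set \<Rightarrow> complex \<Rightarrow> real" where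
  "smoothed a d N A z =
     (\<Sum>s\<in>A. (cmod (\<Sum>i\<le>d. a i * (z * cis (- 2 * pi * of_int s / real N)) ^ i))\<^sup>2) / real N"

lemma smoothed_nonneg: "smoothed a d N A z \<ge> 0"
  by (simp add: smoothed_def sum_nonneg)

text \<open>Squaring out the modulus gives one term for each pair of exponents. The pairs are not
  collected by their difference, so that inserting character values yields
  \<open>X u * cnj (X v)\<close> directly. On the diagonal the phases of the shifts cancel, leaving
  the mass of \<open>A\<close> times the unit square norm of \<open>a\<close>: the mean over the
  circle.\<close>

lemma smoothed_expand:
  fixes a :: "nat \<Rightarrow> complex"
  assumes norm: "(\<Sum>i\<le>d. (cmod (a i))\<^sup>2) = 1"
  obtains b :: "nat \<times> nat \<Rightarrow> complex" where
    "\<And>z. of_real (smoothed a d N A z) = (\<Sum>x\<in>{..d} \<times> {..d}. b x * (z ^ fst x * cnj (z ^ snd x)))"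
    "(\<Sum>i\<le>d. b (i, i)) = of_real (real (card A) / real N)"
proof -
  define e where "e = (\<lambda>s. cis (- 2 * pi * of_int s / real N))"
  define b where "b = (\<lambda>(i, j). (\<Sum>s\<in>A. a i * e s ^ i * cnj (a j * e s ^ j)) / of_nat N)"
  have "of_real (smoothed a d N A z) = (\<Sum>x\<in>{..d} \<times> {..d}. b x * (z ^ fst x * cnj (z ^ snd x)))" for z
  proof -
    have "complex_of_real ((cmod (\<Sum>i\<le>d. a i * (z * e s) ^ i))\<^sup>2) =
      (\<Sum>(i, j)\<in>{..d} \<times> {..d}. a i * e s ^ i * cnj (a j * e s ^ j) * (z ^ i * cnj (z ^ j)))" for s
    proof -
      have "complex_of_real ((cmod (\<Sum>i\<le>d. a i * (z * e s) ^ i))\<^sup>2) =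
        (\<Sum>i\<le>d. a i * (z * e s) ^ i) * cnj (\<Sum>i\<le>d. a i * (z * e s) ^ i)"
        by (rule complex_norm_square)
      also have "\<dots> = (\<Sum>i\<le>d. \<Sum>j\<le>d. (a i * (z * e s) ^ i) * cnj (a j * (z * e s) ^ j))"
        by (simp only: cnj_sum sum_product)
      also have "\<dots> = (\<Sum>i\<le>d. \<Sum>j\<le>d. a i * e s ^ i * cnj (a j * e s ^ j) * (z ^ i * cnj (z ^ j)))"
        by (simp only: power_mult_distrib complex_cnj_mult mult_ac)
      finally show ?thesis by (simp only: sum.cartesian_product)
    qed
    hence "of_real (smoothed a d N A z) =
      (\<Sum>s\<in>A. \<Sum>(i, j)\<in>{..d} \<times> {..d}. a i * e s ^ i * cnj (a j * e s ^ j) * (z ^ i * cnj (z ^ j))) / of_nat N"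
      by (simp only: smoothed_def e_def of_real_divide of_real_sum of_real_of_nat_eq)
    also have "\<dots> = (\<Sum>x\<in>{..d} \<times> {..d}. \<Sum>s\<in>A. case x of (i, j) \<Rightarrow>
        a i * e s ^ i * cnj (a j * e s ^ j) * (z ^ i * cnj (z ^ j))) / of_nat N"
      by (subst sum.swap) (rule refl)
    also have "\<dots> = (\<Sum>x\<in>{..d} \<times> {..d}. b x * (z ^ fst x * cnj (z ^ snd x)))"
      unfolding sum_divide_distrib
      by (rule sum.cong) (auto simp: b_def sum_distrib_right sum_divide_distrib)
    finally show ?thesis .
  qed
  moreover have "(\<Sum>i\<le>d. b (i, i)) = of_real (real (card A) / real N)"
  proof -
    have e: "e s ^ i * cnj (e s ^ i) = 1" for s i
      unfolding complex_norm_square[symmetric] by (simp add: e_def norm_power)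
    have "a i * e s ^ i * cnj (a i * e s ^ i) = of_real ((cmod (a i))\<^sup>2)" for i s
    proof -
      have "a i * e s ^ i * cnj (a i * e s ^ i) = (a i * cnj (a i)) * (e s ^ i * cnj (e s ^ i))"
        by (simp only: complex_cnj_mult mult_ac)
      thus ?thesis by (simp only: e complex_norm_square mult_1_right)
    qed
    hence "b (i, i) = of_nat (card A) / of_nat N * of_real ((cmod (a i))\<^sup>2)" for i
      by (simp add: b_def)
    hence "(\<Sum>i\<le>d. b (i, i)) = of_nat (card A) / of_nat N * of_real (\<Sum>i\<le>d. (cmod (a i))\<^sup>2)"
      by (simp only: sum_distrib_left of_real_sum)
    thus ?thesis by (simp add: norm)
  qed
  ultimately show ?thesis by (rule that)
qed

section \<open>Unique factorisation and the mean over all characters\<close>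

lemma prod_prime_powers_inj:
  fixes p :: "'j \<Rightarrow> nat"
  assumes "finite J" "inj_on p J" "\<And>j. j \<in> J \<Longrightarrow> prime (p j)"
    and eq: "(\<Prod>j\<in>J. p j ^ f j) = (\<Prod>j\<in>J. p j ^ g j)" and "i \<in> J"
  shows "f i = g i"
proof -
  have "multiplicity (p i) (\<Prod>j\<in>J. p j ^ h j) = h i" for h :: "'j \<Rightarrow> nat"
  proof -
    have "multiplicity (p i) (\<Prod>j\<in>J. p j ^ h j) = (\<Sum>j\<in>J. multiplicity (p i) (p j ^ h j))"
    proof (rule prime_elem_multiplicity_prod_distrib)
      show "prime_elem (p i)" using assms by simp
      show "0 \<notin> (\<lambda>j. p j ^ h j) ` J" using assms(3) prime_gt_0_nat by fastforce
    qed fact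
    also have "\<dots> = (\<Sum>j\<in>J. if j = i then h j else 0)"
    proof (rule sum.cong)
      fix j assume j: "j \<in> J"
      show "multiplicity (p i) (p j ^ h j) = (if j = i then h j else 0)"
      proof (cases "j = i")
        case True
        thus ?thesis using assms(3)[OF j] prime_gt_1_nat[of "p j"]
          by (simp add: multiplicity_same_power)
      next
        case False
        hence "p i \<noteq> p j" using assms(2,5) j by (auto dest: inj_onD)
        thus ?thesis using assms(3)[OF j] assms(3)[OF assms(5)] False
          by (simp add: multiplicity_distinct_prime_power)
      qed
    qed simp
    also have "\<dots> = h i" using assms(1,5) by simp
    finally show ?thesis .
  qed
  from this[of f] this[of g] show ?thesis using eq by simp
qed

text \<open>This is the independence statement: the mean of the product is the product of the means.
  After expansion a term is given by a choice \<open>f\<close> of an exponent pair for each prime.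
  Orthogonality keeps it exactly when all the pairs are diagonal. That condition is a product of
  indicators over \<open>J\<close>, so distributivity read backwards folds the surviving terms into
  a product of diagonal sums.\<close>

lemma sum_characters_prod_smoothed:
  fixes a :: "nat \<Rightarrow> complex" and p :: "'j \<Rightarrow> nat"
  assumes q: "prime q" and J: "finite J" "inj_on p J" "\<And>j. j \<in> J \<Longrightarrow> prime (p j)"
    and small: "\<And>j. j \<in> J \<Longrightarrow> p j < q" "(\<Prod>j\<in>J. p j ^ d) < q"
    and norm: "(\<Sum>i\<le>d. (cmod (a i))\<^sup>2) = 1"
  shows "(\<Sum>X | dirichlet_character q X. \<Prod>j\<in>J. smoothed a d N (A j) (X (int (p j)))) =
    real (q - 1) * (\<Prod>j\<in>J. real (card (A j)) / real N)"
proof -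
  define D where "D = {..d} \<times> {..d}"
  have finD: "finite D" by (simp add: D_def)
  have "\<exists>b :: nat \<times> nat \<Rightarrow> complex.
    (\<forall>z. of_real (smoothed a d N (A j) z) = (\<Sum>x\<in>D. b x * (z ^ fst x * cnj (z ^ snd x)))) \<and>
    (\<Sum>i\<le>d. b (i, i)) = of_real (real (card (A j)) / real N)" for j
  proof (rule smoothed_expand[OF norm, where N = N and A = "A j"])
    fix b assume b: "\<And>z. of_real (smoothed a d N (A j) z) =
        (\<Sum>x\<in>{..d} \<times> {..d}. b x * (z ^ fst x * cnj (z ^ snd x)))"
      "(\<Sum>i\<le>d. b (i, i)) = of_real (real (card (A j)) / real N)"
    show ?thesis
      unfolding D_def using b by (intro exI[of _ b] conjI allI)
  qed
  hence "\<exists>b. \<forall>j.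
    (\<forall>z. of_real (smoothed a d N (A j) z) = (\<Sum>x\<in>D. b j x * (z ^ fst x * cnj (z ^ snd x)))) \<and>
    (\<Sum>i\<le>d. b j (i, i)) = complex_of_real (real (card (A j)) / real N)"
    by (intro choice allI)
  then obtain b :: "'j \<Rightarrow> nat \<times> nat \<Rightarrow> complex" where b':
    "\<forall>j. (\<forall>z. of_real (smoothed a d N (A j) z) = (\<Sum>x\<in>D. b j x * (z ^ fst x * cnj (z ^ snd x)))) \<and>
    (\<Sum>i\<le>d. b j (i, i)) = complex_of_real (real (card (A j)) / real N)" ..
  have b: "of_real (smoothed a d N (A j) z) = (\<Sum>x\<in>D. b j x * (z ^ fst x * cnj (z ^ snd x)))"
    for j z using b' by blast
  have bsum: "(\<Sum>i\<le>d. b j (i, i)) = of_real (real (card (A j)) / real N)" for j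
    using b' by blast
  have cop: "coprime (int (p j)) (int q)" if "j \<in> J" for j
    using primes_coprime[of "p j" q] J(3)[OF that] q small(1)[OF that] by auto
  have orth: "(\<Sum>X | dirichlet_character q X.
        \<Prod>j\<in>J. X (int (p j)) ^ fst (f j) * cnj (X (int (p j)) ^ snd (f j))) =
      (\<Prod>j\<in>J. if fst (f j) = snd (f j) then 1 else 0) * of_nat (q - 1)"
    if f: "f \<in> (\<Pi>\<^sub>E j\<in>J. D)" for f
  proof -
    define u where "u = (\<Prod>j\<in>J. p j ^ fst (f j))"
    define v where "v = (\<Prod>j\<in>J. p j ^ snd (f j))"
    have less: "(\<Prod>j\<in>J. p j ^ h j) < q" if "\<And>j. j \<in> J \<Longrightarrow> h j \<le> d" for h
    proof -
      have "(\<Prod>j\<in>J. p j ^ h j) \<le> (\<Prod>j\<in>J. p j ^ d)"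
        using that J(3) prime_gt_0_nat by (intro prod_mono) (auto intro!: power_increasing Suc_leI)
      with small(2) show ?thesis by linarith
    qed
    have fj: "fst (f j) \<le> d" "snd (f j) \<le> d" if "j \<in> J" for j
      using PiE_mem[OF f that] by (auto simp: D_def)
    have uv: "u < q" "v < q" unfolding u_def v_def by (intro less fj; assumption)+
    have cu: "coprime (int u) (int q)" "coprime (int v) (int q)"
      unfolding u_def v_def of_nat_prod of_nat_power
      by (intro prod_coprime_left coprime_power_left_iff[THEN iffD2] disjI1 cop; assumption)+
    have "(\<Prod>j\<in>J. X (int (p j)) ^ fst (f j) * cnj (X (int (p j)) ^ snd (f j))) =
        X (int u) * cnj (X (int v))" if "dirichlet_character q X" for X
      unfolding u_def v_def of_nat_prod of_nat_power dirichlet_character_prod[OF that]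
        dirichlet_character_power[OF that] cnj_prod prod.distrib by (rule refl)
    hence "(\<Sum>X | dirichlet_character q X.
        \<Prod>j\<in>J. X (int (p j)) ^ fst (f j) * cnj (X (int (p j)) ^ snd (f j))) =
        (\<Sum>X | dirichlet_character q X. X (int u) * cnj (X (int v)))"
      by (intro sum.cong) auto
    also have "\<dots> = (if [int u = int v] (mod int q) then of_nat (q - 1) else 0)"
      by (rule dirichlet_character_orthogonality[OF q cu])
    \<comment> \<open>Both numbers are below \<open>q\<close>, so congruence is equality. This is
      what limits the degree \<open>d\<close>.\<close>
    also have "[int u = int v] (mod int q) \<longleftrightarrow> u = v"
      using uv by (auto simp: cong_int_iff cong_less_modulus_unique_nat)
    also have "u = v \<longleftrightarrow> (\<forall>j\<in>J. fst (f j) = snd (f j))"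
      using prod_prime_powers_inj[OF J, of "\<lambda>j. fst (f j)" "\<lambda>j. snd (f j)"]
      by (auto simp: u_def v_def)
    also have "(if \<forall>j\<in>J. fst (f j) = snd (f j) then of_nat (q - 1) else 0) =
      (\<Prod>j\<in>J. if fst (f j) = snd (f j) then 1 else 0) * (of_nat (q - 1) :: complex)"
      using J(1) by (auto simp: prod_zero_iff intro!: prod.neutral)
    finally show ?thesis .
  qed
  have "complex_of_real (\<Sum>X | dirichlet_character q X. \<Prod>j\<in>J. smoothed a d N (A j) (X (int (p j)))) =
    (\<Sum>X | dirichlet_character q X. \<Prod>j\<in>J. \<Sum>x\<in>D.
       b j x * (X (int (p j)) ^ fst x * cnj (X (int (p j)) ^ snd x)))"
    by (simp only: of_real_sum of_real_prod b)
  also have "\<dots> = (\<Sum>X | dirichlet_character q X. \<Sum>f\<in>(\<Pi>\<^sub>E j\<in>J. D). \<Prod>j\<in>J.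
       b j (f j) * (X (int (p j)) ^ fst (f j) * cnj (X (int (p j)) ^ snd (f j))))"
    by (simp only: prod_sum_PiE[OF J(1) finD])
  also have "\<dots> = (\<Sum>f\<in>(\<Pi>\<^sub>E j\<in>J. D). (\<Prod>j\<in>J. b j (f j)) *
     (\<Sum>X | dirichlet_character q X. 
        \<Prod>j\<in>J. X (int (p j)) ^ fst (f j) * cnj (X (int (p j)) ^ snd (f j))))"
    by (subst sum.swap) (simp only: prod.distrib sum_distrib_left)
  also have "\<dots> = (\<Sum>f\<in>(\<Pi>\<^sub>E j\<in>J. D). (\<Prod>j\<in>J. b j (f j)) *
      ((\<Prod>j\<in>J. if fst (f j) = snd (f j) then 1 else 0) * of_nat (q - 1)))"
    by (intro sum.cong refl arg_cong2[where f = "(*)"] orth)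
  also have "\<dots> = (\<Sum>f\<in>(\<Pi>\<^sub>E j\<in>J. D). \<Prod>j\<in>J. b j (f j) *
      (if fst (f j) = snd (f j) then 1 else 0)) * of_nat (q - 1)"
    by (simp only: sum_distrib_right prod.distrib mult.assoc)
  also have "\<dots> = (\<Prod>j\<in>J. \<Sum>x\<in>D. b j x * (if fst x = snd x then 1 else 0)) * of_nat (q - 1)"
    by (simp only: prod_sum_PiE[OF J(1) finD])
  also have "\<dots> = (\<Prod>j\<in>J. \<Sum>i\<le>d. b j (i, i)) * of_nat (q - 1)"
  proof -
    have "(\<Sum>x\<in>D. b j x * (if fst x = snd x then 1 else 0)) = (\<Sum>i\<le>d. b j (i, i))" for j
    proof -
      have "(\<Sum>x\<in>D. b j x * (if fst x = snd x then 1 else 0)) =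
        (\<Sum>i\<le>d. \<Sum>k\<le>d. b j (i, k) * (if i = k then 1 else 0))"
        by (simp only: D_def sum.cartesian_product) (simp add: case_prod_unfold)
      also have "\<dots> = (\<Sum>i\<le>d. b j (i, i))"
        by (intro sum.cong) (auto simp: if_distrib cong: if_cong)
      finally show ?thesis .
    qed
    thus ?thesis by simp
  qed
  also have "\<dots> = complex_of_real (real (q - 1) * (\<Prod>j\<in>J. real (card (A j)) / real N))"
    by (simp only: bsum of_real_mult of_real_prod of_real_of_nat_eq mult.commute)
  finally show ?thesis by (simp only: of_real_eq_iff)
qed

section \<open>The kernel and the smoothed indicators away from their intervals\<close>

text \<open>Sine is concave on the interval from 0 to \<open>pi\<close>, so it lies above its chord
  from 0 to \<open>pi / 2\<close>.\<close>

lemma sin_ge_Jordan: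
  fixes x :: real
  assumes "0 \<le> x" "x \<le> pi / 2"
  shows "sin x \<ge> 2 * x / pi"
proof -
  have "concave_on {0..pi} (sin :: real \<Rightarrow> real)"
  proof (rule f''_le0_imp_concave)
    show "(sin has_real_derivative cos x) (at x)" for x :: real by (rule DERIV_sin)
    show "(cos has_real_derivative - sin x) (at x)" for x :: real by (rule DERIV_cos)
  qed (auto intro: sin_ge_zero)
  moreover have "0 \<le> 2 * x / pi" "2 * x / pi \<le> 1" using assms pi_gt_zero by (auto simp: field_simps)
  ultimately have "(1 - 2 * x / pi) * sin 0 + (2 * x / pi) * sin (pi / 2) \<le>
      sin ((1 - 2 * x / pi) *\<^sub>R 0 + (2 * x / pi) *\<^sub>R (pi / 2))"
    by (intro concave_onD) auto
  thus ?thesis by simp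
qed

lemma norm_one_minus_cis: "cmod (1 - cis x) = 2 * \<bar>sin (x / 2)\<bar>"
proof -
  have "(cmod (1 - cis x))\<^sup>2 = 2 - 2 * cos x"
    using sin_cos_squared_add[of x] by (simp add: cmod_power2 power2_diff)
  also have "cos x = 1 - 2 * (sin (x / 2))\<^sup>2"
    using cos_double_sin[of "x / 2"] by simp
  finally have "(cmod (1 - cis x))\<^sup>2 = (2 * \<bar>sin (x / 2)\<bar>)\<^sup>2" by (simp add: power_mult_distrib)
  thus ?thesis by (rule power2_eq_imp_eq) auto
qed

lemma norm_one_minus_cis_ge:
  assumes "\<eta> \<le> \<bar>u\<bar>" "\<bar>u\<bar> \<le> 1 - \<eta>" "0 < \<eta>"
  shows "cmod (1 - cis (2 * pi * u)) \<ge> 4 * \<eta>"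
proof -
  have "\<bar>sin (pi * u)\<bar> = sin (pi * \<bar>u\<bar>)"
  proof -
    have "sin (pi * \<bar>u\<bar>) \<ge> 0" using assms by (intro sin_ge_zero) auto
    thus ?thesis by (cases "u \<ge> 0") auto
  qed
  moreover have "sin (pi * \<bar>u\<bar>) \<ge> 2 * \<eta>"
  proof (cases "\<bar>u\<bar> \<le> 1/2")
    case True
    hence "sin (pi * \<bar>u\<bar>) \<ge> 2 * \<bar>u\<bar>" using sin_ge_Jordan[of "pi * \<bar>u\<bar>"] by simp
    thus ?thesis using assms by simp
  next
    \<comment> \<open>Beyond one half the distance to the nearest integer is
      \<open>1 - \<bar>u\<bar>\<close>, and the sine is symmetric about
      \<open>pi / 2\<close>.\<close>
    case False
    hence "sin (pi * (1 - \<bar>u\<bar>)) \<ge> 2 * (1 - \<bar>u\<bar>)"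
      using sin_ge_Jordan[of "pi * (1 - \<bar>u\<bar>)"] assms by simp
    moreover have "sin (pi * (1 - \<bar>u\<bar>)) = sin (pi * \<bar>u\<bar>)"
      by (simp add: right_diff_distrib sin_diff)
    ultimately show ?thesis using assms by simp
  qed
  ultimately show ?thesis by (simp add: norm_one_minus_cis mult.assoc)
qed

text \<open>In the closed form of the geometric sum the numerator is at most 2 and the denominator
  at least \<open>4 * \<eta>\<close>.\<close>

lemma norm_geometric_cis_le:
  assumes "\<eta> \<le> \<bar>u\<bar>" "\<bar>u\<bar> \<le> 1 - \<eta>" "0 < \<eta>"
  shows "cmod (\<Sum>i<H. cis (2 * pi * u) ^ i) \<le> 1 / (2 * \<eta>)"
proof -
  define z where "z = cis (2 * pi * u)"
  have ge: "cmod (1 - z) \<ge> 4 * \<eta>" unfolding z_def by (rule norm_one_minus_cis_ge[OF assms])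
  hence "z \<noteq> 1" using assms by auto
  have "cmod (1 - z ^ H) \<le> 1 + cmod (z ^ H)" using norm_triangle_ineq4[of 1 "z ^ H"] by simp
  also have "\<dots> = 2" by (simp add: z_def norm_power)
  finally have le: "cmod (1 - z ^ H) \<le> 2" .
  have "cmod (\<Sum>i<H. z ^ i) = cmod (1 - z ^ H) / cmod (1 - z)"
    using \<open>z \<noteq> 1\<close> by (simp add: sum_gp_strict norm_divide)
  also have "\<dots> \<le> 2 / (4 * \<eta>)"
    using le ge assms by (intro frac_le) auto
  finally show ?thesis by (simp add: z_def)
qed

text \<open>The coefficients are those of the \<open>r\<close>-th power of the Dirichlet polynomial of length \<open>H\<close>,
  scaled to unit \<open>\<ell>\<^sup>2\<close> norm, so that the squared modulus is a normalised Jackson kernel.\<close>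

lemma jackson_kernel:
  assumes "H > 0" "0 < \<eta>"
  obtains a :: "nat \<Rightarrow> complex" where
    "(\<Sum>i\<le>r * (H - 1). (cmod (a i))\<^sup>2) = 1"
    "\<And>u. \<eta> \<le> \<bar>u\<bar> \<Longrightarrow> \<bar>u\<bar> \<le> 1 - \<eta> \<Longrightarrow>
       (cmod (\<Sum>i\<le>r * (H - 1). a i * cis (2 * pi * u) ^ i))\<^sup>2
         \<le> real (r * (H - 1) + 1) / (2 * \<eta> * real H) ^ (2 * r)"
proof -
  define d where "d = r * (H - 1)"
  define p :: "complex poly" where "p = (\<Sum>i<H. Polynomial.monom 1 i) ^ r"
  have "degree (\<Sum>i<H. Polynomial.monom (1::complex) i) \<le> H - 1"
    using assms by (intro degree_sum_le) (auto intro: order.trans[OF Polynomial.degree_monom_le])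
  hence "degree p \<le> d"
    using degree_power_le[of "\<Sum>i<H. Polynomial.monom (1::complex) i" r] mult_le_mono2
    unfolding p_def d_def by (metis mult.commute order.trans)
  hence p: "(\<Sum>i\<le>d. poly.coeff p i * z ^ i) = (\<Sum>i<H. z ^ i) ^ r" for z
  proof -
    have "(\<Sum>i\<le>d. poly.coeff p i * z ^ i) = poly p z"
      unfolding poly_altdef using \<open>degree p \<le> d\<close>
      by (intro sum.mono_neutral_right) (auto simp: coeff_eq_0)
    thus ?thesis by (simp add: p_def poly_sum poly_monom)
  qed
  define c where "c = (\<Sum>i\<le>d. (cmod (poly.coeff p i))\<^sup>2)"
  \<comment> \<open>At \<open>z = 1\<close> the polynomial has the value \<open>H ^ r\<close>.
    Cauchy-Schwarz over its \<open>d + 1\<close> coefficients turns this into a lower bound for the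
    squared norm \<open>c\<close>, and produces the factor \<open>d + 1\<close> in the final
    estimate.\<close>
  have "real H ^ r = cmod (\<Sum>i\<le>d. poly.coeff p i)"
    using p[of 1] by (simp add: norm_power)
  also have "\<dots> \<le> (\<Sum>i\<le>d. cmod (poly.coeff p i))" by (rule norm_sum)
  finally have "(real H ^ r)\<^sup>2 \<le> (\<Sum>i\<le>d. cmod (poly.coeff p i))\<^sup>2"
    by (rule power_mono) simp
  also have "\<dots> \<le> c * real (d + 1)"
    using sum_squared_le_sum_of_squares[of "\<lambda>i. cmod (poly.coeff p i)" "{..d}"] by (simp add: c_def)
  finally have c: "(real H ^ r)\<^sup>2 \<le> c * real (d + 1)" .
  have Hpos: "(real H ^ r)\<^sup>2 > 0" using assms by simp
  hence "c * real (d + 1) > 0" using c by linarith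
  hence cpos: "c > 0" by (simp add: zero_less_mult_iff)
  define a where "a = (\<lambda>i. poly.coeff p i / of_real (sqrt c))"
  have sq: "(cmod (x / of_real (sqrt c)))\<^sup>2 = (cmod x)\<^sup>2 / c" for x
    using cpos by (simp add: norm_divide power_divide)
  have "(\<Sum>i\<le>d. (cmod (a i))\<^sup>2) = 1"
    using cpos by (simp only: a_def sq sum_divide_distrib[symmetric] c_def[symmetric]) simp
  moreover have "(cmod (\<Sum>i\<le>d. a i * cis (2 * pi * u) ^ i))\<^sup>2 \<le> real (d + 1) / (2 * \<eta> * real H) ^ (2 * r)"
    if "\<eta> \<le> \<bar>u\<bar>" "\<bar>u\<bar> \<le> 1 - \<eta>" for u
  proof -
    have "(\<Sum>i\<le>d. a i * cis (2 * pi * u) ^ i) = (\<Sum>i<H. cis (2 * pi * u) ^ i) ^ r / of_real (sqrt c)"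
      by (simp add: a_def sum_divide_distrib flip: p)
    hence "(cmod (\<Sum>i\<le>d. a i * cis (2 * pi * u) ^ i))\<^sup>2 = (cmod (\<Sum>i<H. cis (2 * pi * u) ^ i) ^ r)\<^sup>2 / c"
      by (simp only: sq norm_power)
    also have "\<dots> \<le> ((1 / (2 * \<eta>)) ^ r)\<^sup>2 / ((real H ^ r)\<^sup>2 / real (d + 1))"
      using c Hpos cpos norm_geometric_cis_le[OF that assms(2)] assms(2)
      by (intro frac_le power_mono) (auto simp: field_simps)
    also have "\<dots> = real (d + 1) / (2 * \<eta> * real H) ^ (2 * r)"
    proof -
      have "(x ^ r)\<^sup>2 = x ^ (2 * r)" for x :: real
        by (simp only: power_mult[symmetric] mult.commute)
      thus ?thesis by (simp only: power_mult_distrib[of "2 * \<eta>"] power_one_over) simp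
    qed
    finally show ?thesis .
  qed
  ultimately show ?thesis unfolding d_def by (rule that)
qed

section \<open>Mass of the smoothed indicators and their bounds near and far from the
  interval\<close>

lemma smoothed_mono: "finite B \<Longrightarrow> A \<subseteq> B \<Longrightarrow> smoothed a d N A z \<le> smoothed a d N B z"
  unfolding smoothed_def by (intro divide_right_mono sum_mono2) auto

text \<open>Exponents differ by at most \<open>d < N\<close>, so summing over all \<open>N\<close>
  shifts kills every off-diagonal term exactly. The starting point \<open>m\<close> is left free
  because one application centres the period at the angle under study.\<close>

lemma smoothed_full_period:
  assumes norm: "(\<Sum>i\<le>d. (cmod (a i))\<^sup>2) = 1" and N: "d < N" and z: "cmod z = 1"
  shows "smoothed a d N {m..<m + int N} z = 1"
proof -
  define w where "w = cis (2 * pi / real N)"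
  define e where "e = (\<lambda>s::int. cis (- 2 * pi * of_int s / real N))"
  have N0: "N > 0" using N by simp
  have unit: "x ^ i * cnj (x ^ i) = 1" if "cmod x = 1" for x i
    unfolding complex_norm_square[symmetric] using that by (simp add: norm_power)
  have e: "e (m + int t) = e m * cnj (w ^ t)" for t
  proof -
    have "e (m + int t) = cis (- 2 * pi * of_int m / real N + (- (real t * (2 * pi / real N))))"
      by (simp add: e_def add_divide_distrib diff_divide_distrib algebra_simps)
    also have "\<dots> = e m * cnj (w ^ t)"
      unfolding w_def Complex.DeMoivre cis_cnj cis_mult[symmetric] e_def by simp
    finally show ?thesis .
  qed
  have orth: "(\<Sum>s\<in>{m..<m + int N}. e s ^ i * cnj (e s ^ j)) = (if i = j then of_nat N else 0)"
    if "i < N" "j < N" for i j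
  proof -
    have "(\<Sum>s\<in>{m..<m + int N}. e s ^ i * cnj (e s ^ j)) =
      (\<Sum>t<N. e (m + int t) ^ i * cnj (e (m + int t) ^ j))"
    proof (rule sum.reindex_bij_witness[of _ "\<lambda>t. m + int t" "\<lambda>s. nat (s - m)"])
    qed auto
    \<comment> \<open>The shifts run through the conjugates of the powers of \<open>w\<close>, which
      exchanges the roles of \<open>i\<close> and \<open>j\<close>.\<close>
    also have "\<dots> = (\<Sum>t<N. e m ^ i * cnj (e m ^ j) * (w ^ (t * j) * cnj (w ^ (t * i))))"
      by (simp add: e power_mult_distrib power_mult mult_ac)
    also have "\<dots> = e m ^ i * cnj (e m ^ j) * (if j = i then of_nat N else 0)"
      unfolding sum_distrib_left[symmetric] w_def by (subst sum_root_unity_orthogonal[OF that(2,1)]) (rule refl)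
    also have "\<dots> = (if i = j then of_nat N else 0)"
      using unit[of "e m" i] by (auto simp: e_def)
    finally show ?thesis .
  qed
  have "complex_of_real ((cmod (\<Sum>i\<le>d. a i * (z * e s) ^ i))\<^sup>2) =
      (\<Sum>i\<le>d. \<Sum>j\<le>d. a i * z ^ i * cnj (a j * z ^ j) * (e s ^ i * cnj (e s ^ j)))" for s
  proof -
    have "complex_of_real ((cmod (\<Sum>i\<le>d. a i * (z * e s) ^ i))\<^sup>2) =
      (\<Sum>i\<le>d. a i * (z * e s) ^ i) * cnj (\<Sum>i\<le>d. a i * (z * e s) ^ i)"
      by (rule complex_norm_square)
    also have "\<dots> = (\<Sum>i\<le>d. \<Sum>j\<le>d. (a i * (z * e s) ^ i) * cnj (a j * (z * e s) ^ j))"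
      by (simp only: cnj_sum sum_product)
    finally show ?thesis by (simp only: power_mult_distrib complex_cnj_mult mult_ac)
  qed
  hence "complex_of_real (smoothed a d N {m..<m + int N} z) =
      (\<Sum>s\<in>{m..<m + int N}. \<Sum>i\<le>d. \<Sum>j\<le>d. a i * z ^ i * cnj (a j * z ^ j) * (e s ^ i * cnj (e s ^ j))) / of_nat N"
    by (simp only: smoothed_def e_def of_real_divide of_real_sum of_real_of_nat_eq)
  also have "(\<Sum>s\<in>{m..<m + int N}. \<Sum>i\<le>d. \<Sum>j\<le>d. a i * z ^ i * cnj (a j * z ^ j) * (e s ^ i * cnj (e s ^ j))) =
      (\<Sum>i\<le>d. \<Sum>s\<in>{m..<m + int N}. \<Sum>j\<le>d. a i * z ^ i * cnj (a j * z ^ j) * (e s ^ i * cnj (e s ^ j)))"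
    by (rule sum.swap)
  also have "\<dots> = (\<Sum>i\<le>d. \<Sum>j\<le>d. \<Sum>s\<in>{m..<m + int N}. a i * z ^ i * cnj (a j * z ^ j) * (e s ^ i * cnj (e s ^ j)))"
    by (intro sum.cong refl sum.swap)
  also have "\<dots> = (\<Sum>i\<le>d. \<Sum>j\<le>d. a i * z ^ i * cnj (a j * z ^ j) * (if i = j then of_nat N else 0))"
    unfolding sum_distrib_left[symmetric] using N
    by (intro sum.cong refl arg_cong2[where f = "(*)"] orth) auto
  also have "\<dots> = (\<Sum>i\<le>d. a i * z ^ i * cnj (a i * z ^ i) * of_nat N)"
    by (intro sum.cong) (auto simp: if_distrib cong: if_cong)
  also have "\<dots> = (\<Sum>i\<le>d. of_real ((cmod (a i))\<^sup>2) * of_nat N)"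
  proof (intro sum.cong refl)
    fix i
    have "a i * z ^ i * cnj (a i * z ^ i) = (a i * cnj (a i)) * (z ^ i * cnj (z ^ i))"
      by (simp only: complex_cnj_mult mult_ac)
    thus "a i * z ^ i * cnj (a i * z ^ i) * of_nat N = of_real ((cmod (a i))\<^sup>2) * of_nat N"
      by (simp only: unit[OF z] complex_norm_square mult_1_right)
  qed
  also have "\<dots> = of_real (\<Sum>i\<le>d. (cmod (a i))\<^sup>2) * of_nat N"
    by (simp only: of_real_sum sum_distrib_right)
  also have "\<dots> / of_nat N = complex_of_real 1" using N0 by (simp add: norm)
  finally show ?thesis by (simp only: of_real_eq_iff)
qed

lemma smoothed_le_1:
  assumes "(\<Sum>i\<le>d. (cmod (a i))\<^sup>2) = 1" "d < N" "cmod z = 1" "A \<subseteq> {m..<m + int N}"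
  shows "smoothed a d N A z \<le> 1"
  using smoothed_mono[OF _ assms(4), of a d N z] smoothed_full_period[OF assms(1-3), of m] by simp

text \<open>The two conditions on \<open>\<theta> - s / N\<close> keep it at distance at least
  \<open>\<eta>\<close> from -1, 0 and 1, so that each summand is bounded by
  \<open>\<kappa>\<close>.\<close>

lemma smoothed_le_card:
  assumes "\<And>u. \<eta> \<le> \<bar>u\<bar> \<Longrightarrow> \<bar>u\<bar> \<le> 1 - \<eta> \<Longrightarrow> (cmod (\<Sum>i\<le>d. a i * cis (2 * pi * u) ^ i))\<^sup>2 \<le> \<kappa>"
    and "\<And>s. s \<in> A \<Longrightarrow> \<eta> \<le> \<bar>\<theta> - of_int s / real N\<bar> \<and> \<bar>\<theta> - of_int s / real N\<bar> \<le> 1 - \<eta>"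
  shows "smoothed a d N A (cis (2 * pi * \<theta>)) \<le> \<kappa> * (real (card A) / real N)"
proof -
  have eq: "cis (2 * pi * \<theta>) * cis (- 2 * pi * of_int s / real N) = cis (2 * pi * (\<theta> - of_int s / real N))" for s
    by (simp add: cis_mult algebra_simps)
  have "(\<Sum>s\<in>A. (cmod (\<Sum>i\<le>d. a i * (cis (2 * pi * \<theta>) * cis (- 2 * pi * of_int s / real N)) ^ i))\<^sup>2) \<le> of_nat (card A) * \<kappa>"
    unfolding eq by (intro sum_bounded_above assms(1)) (use assms(2) in auto)
  thus ?thesis unfolding smoothed_def by (simp add: divide_right_mono mult.commute)
qed

text \<open>The full period \<open>W\<close> centred at \<open>\<theta>\<close> has total 1, and its
  shifts outside \<open>A\<close> are at distance between \<open>\<eta>\<close> and one half, so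
  they contribute at most \<open>\<kappa>\<close>. The set \<open>A\<close> may extend beyond one
  period, as an enlarged interval can be longer than the circle.\<close>

lemma smoothed_ge:
  assumes norm: "(\<Sum>i\<le>d. (cmod (a i))\<^sup>2) = 1" and N: "d < N" and \<eta>: "\<eta> \<le> 1/2"
    and \<kappa>: "\<And>u. \<eta> \<le> \<bar>u\<bar> \<Longrightarrow> \<bar>u\<bar> \<le> 1 - \<eta> \<Longrightarrow> (cmod (\<Sum>i\<le>d. a i * cis (2 * pi * u) ^ i))\<^sup>2 \<le> \<kappa>"
    and "\<kappa> \<ge> 0" and A: "finite A" "\<And>s. \<bar>\<theta> - of_int s / real N\<bar> < \<eta> \<Longrightarrow> s \<in> A"
  shows "smoothed a d N A (cis (2 * pi * \<theta>)) \<ge> 1 - \<kappa>"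
proof -
  have N0: "real N > 0" using N by simp
  define m where "m = \<lceil>real N * (\<theta> - 1/2)\<rceil>"
  define W where "W = {m..<m + int N}"
  have W: "\<bar>\<theta> - of_int s / real N\<bar> \<le> 1/2" if "s \<in> W" for s
  proof -
    have "of_int s \<ge> real N * (\<theta> - 1/2)" using that unfolding W_def m_def by (simp add: ceiling_le_iff)
    moreover have "s - int N < m" using that by (simp add: W_def)
    hence "of_int s - real N < real N * (\<theta> - 1/2)" unfolding m_def by (simp add: less_ceiling_iff)
    ultimately have "\<theta> - of_int s / real N \<le> 1/2" "- (1/2) \<le> \<theta> - of_int s / real N"
      using N0 by (simp_all add: field_simps)
    thus ?thesis unfolding abs_le_iff by linarith
  qed
  have "1 = smoothed a d N W (cis (2 * pi * \<theta>))"
    unfolding W_def using smoothed_full_period[OF norm N] by simp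
  also have "\<dots> \<le> smoothed a d N (A \<union> (W - A)) (cis (2 * pi * \<theta>))"
    using A(1) by (intro smoothed_mono) (auto simp: W_def)
  also have "\<dots> = smoothed a d N A (cis (2 * pi * \<theta>)) + smoothed a d N (W - A) (cis (2 * pi * \<theta>))"
    unfolding smoothed_def using A(1) by (subst sum.union_disjoint) (auto simp: W_def add_divide_distrib)
  also have "smoothed a d N (W - A) (cis (2 * pi * \<theta>)) \<le> \<kappa> * (real (card (W - A)) / real N)"
  proof (rule smoothed_le_card[OF \<kappa>])
    fix s assume s: "s \<in> W - A"
    show "\<eta> \<le> \<bar>\<theta> - of_int s / real N\<bar> \<and> \<bar>\<theta> - of_int s / real N\<bar> \<le> 1 - \<eta>"
      using A(2)[of s] W[of s] s \<eta> by (auto simp: not_less[symmetric])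
  qed
  also have "\<kappa> * (real (card (W - A)) / real N) \<le> \<kappa> * 1"
  proof (intro mult_left_mono)
    have "card (W - A) \<le> card W" by (intro card_mono) (auto simp: W_def)
    also have "\<dots> = N" by (simp add: W_def)
    finally show "real (card (W - A)) / real N \<le> 1" using N0 by simp
  qed fact
  finally show ?thesis by simp
qed

lemma card_int_between_le:
  fixes x y :: real
  assumes "x \<le> y"
  shows "finite {s::int. x < of_int s \<and> of_int s < y}"
    and "real (card {s::int. x < of_int s \<and> of_int s < y}) \<le> y - x + 1"
    and "real (card {s::int. x < of_int s \<and> of_int s < y}) \<ge> y - x - 1"
proof -
  have eq: "{s::int. x < of_int s \<and> of_int s < y} = {\<lfloor>x\<rfloor><..<\<lceil>y\<rceil>}"
    by (auto simp: floor_less_iff less_ceiling_iff)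
  show "finite {s::int. x < of_int s \<and> of_int s < y}" unfolding eq by simp
  show "real (card {s::int. x < of_int s \<and> of_int s < y}) \<le> y - x + 1"
    using assms unfolding eq by simp linarith
  show "real (card {s::int. x < of_int s \<and> of_int s < y}) \<ge> y - x - 1"
    using assms unfolding eq by simp linarith
qed

section \<open>Counting characters in a box\<close>

lemma cis_frac_Arg:
  assumes "cmod z = 1"
  shows "cis (2 * pi * frac (Arg z / (2 * pi))) = z"
proof -
  have "2 * pi * frac (Arg z / (2 * pi)) = Arg z + 2 * pi * of_int (- \<lfloor>Arg z / (2 * pi)\<rfloor>)"
    by (simp add: frac_def right_diff_distrib)
  also have "cis \<dots> = cis (Arg z) * cis (2 * pi * of_int (- \<lfloor>Arg z / (2 * pi)\<rfloor>))"
    by (rule cis_mult[symmetric])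
  also have "\<dots> = z"
    using assms by (subst cis_multiple_2pi) (auto simp: cis_Arg sgn_eq intro!: cis_Arg[THEN trans])
  finally show ?thesis .
qed

text \<open>The \<open>j\<close>-th interval starts at \<open>c j\<close>. Moving both of its ends
  by \<open>\<eta>\<close> changes the length by \<open>2 * \<eta>\<close>, and counting multiples
  of \<open>1 / N\<close> costs at most another \<open>1 / N \<le> \<eta>\<close>; this is the
  origin of \<open>3 * \<eta>\<close> throughout.\<close>

locale character_box =
  fixes q :: nat and J :: "'j set" and p :: "'j \<Rightarrow> nat" and c \<delta> :: "'j \<Rightarrow> real"
    and a :: "nat \<Rightarrow> complex" and d N :: nat and \<eta> \<kappa> :: real
  assumes q: "prime q" and J: "finite J" "inj_on p J" "\<And>j. j \<in> J \<Longrightarrow> prime (p j)"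
    and small: "\<And>j. j \<in> J \<Longrightarrow> p j < q" "(\<Prod>j\<in>J. p j ^ d) < q"
    and norm: "(\<Sum>i\<le>d. (cmod (a i))\<^sup>2) = 1" and N: "d < N" "1 / real N \<le> \<eta>"
    and eta: "\<eta> \<le> 1/2" and kappa: "0 \<le> \<kappa>" "\<kappa> \<le> 1"
    and kernel: "\<And>u. \<eta> \<le> \<bar>u\<bar> \<Longrightarrow> \<bar>u\<bar> \<le> 1 - \<eta> \<Longrightarrow>
      (cmod (\<Sum>i\<le>d. a i * cis (2 * pi * u) ^ i))\<^sup>2 \<le> \<kappa>"
    and c: "\<And>j. j \<in> J \<Longrightarrow> 0 \<le> c j" "\<And>j. j \<in> J \<Longrightarrow> c j + \<delta> j \<le> 1"
    and delta: "\<And>j. j \<in> J \<Longrightarrow> 3 * \<eta> < \<delta> j"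
begin

abbreviation angle :: "(int \<Rightarrow> complex) \<Rightarrow> 'j \<Rightarrow> real" where
  "angle X j \<equiv> frac (Arg (X (int (p j))) / (2 * pi))"

definition chars :: "(int \<Rightarrow> complex) set" where
  "chars = {X. dirichlet_character q X}"

definition box :: "(int \<Rightarrow> complex) set" where
  "box = {X. dirichlet_character q X \<and> (\<forall>j\<in>J. angle X j \<in> {c j<..<c j + \<delta> j})}"

definition outer :: "'j \<Rightarrow> int set" where
  "outer j = {s. real N * (c j - \<eta>) < of_int s \<and> of_int s < real N * (c j + \<delta> j + \<eta>)}"

definition inner :: "'j \<Rightarrow> int set" where
  "inner j = {s. real N * (c j + \<eta>) < of_int s \<and> of_int s < real N * (c j + \<delta> j - \<eta>)}"

lemma N_pos: "real N > 0" using N by simp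

lemma eta_pos: "\<eta> > 0" using N N_pos by (meson less_le_trans zero_less_divide_1_iff)

lemma N_eta: "1 \<le> real N * \<eta>" using N N_pos by (simp add: field_simps)

lemma finite_chars: "finite chars"
  unfolding chars_def by (rule finite_dirichlet_characters[OF q])

lemma box_subset: "box \<subseteq> chars" by (auto simp: box_def chars_def)

lemma norm_char:
  assumes "X \<in> chars" "j \<in> J"
  shows "cmod (X (int (p j))) = 1"
proof (rule norm_dirichlet_character[OF q])
  show "dirichlet_character q X" using assms by (simp add: chars_def)
  show "coprime (int (p j)) (int q)"
    using primes_coprime[of "p j" q] J(3)[OF assms(2)] q small(1)[OF assms(2)] by auto
qed

lemma char_eq_cis:
  "X \<in> chars \<Longrightarrow> j \<in> J \<Longrightarrow> X (int (p j)) = cis (2 * pi * angle X j)"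
  using cis_frac_Arg norm_char by metis

lemma card_outer:
  assumes "j \<in> J"
  shows "real (card (outer j)) / real N \<le> \<delta> j + 3 * \<eta>" and "finite (outer j)"
proof -
  have le: "real N * (c j - \<eta>) \<le> real N * (c j + \<delta> j + \<eta>)"
    using delta[OF assms] eta_pos N_pos by (intro mult_left_mono) auto
  have "real (card (outer j)) \<le> real N * (c j + \<delta> j + \<eta>) - real N * (c j - \<eta>) + 1"
    unfolding outer_def by (rule card_int_between_le(2)[OF le])
  also have "\<dots> \<le> real N * (\<delta> j + 3 * \<eta>)" using N_eta by (simp add: algebra_simps)
  finally show "real (card (outer j)) / real N \<le> \<delta> j + 3 * \<eta>"
    using N_pos by (simp add: field_simps)
  show "finite (outer j)" unfolding outer_def by (rule card_int_between_le(1)[OF le])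
qed

lemma card_inner:
  assumes "j \<in> J"
  shows "\<delta> j - 3 * \<eta> \<le> real (card (inner j)) / real N" and "finite (inner j)"
    and "inner j \<subseteq> {0..<0 + int N}" and "real (card (inner j)) / real N \<le> 1"
proof -
  have le: "real N * (c j + \<eta>) \<le> real N * (c j + \<delta> j - \<eta>)"
    using delta[OF assms] eta_pos N_pos by (intro mult_left_mono) auto
  have "real N * (\<delta> j - 3 * \<eta>) \<le> real N * (c j + \<delta> j - \<eta>) - real N * (c j + \<eta>) - 1"
    using N_eta by (simp add: algebra_simps)
  also have "\<dots> \<le> real (card (inner j))"
    unfolding inner_def by (rule card_int_between_le(3)[OF le])
  finally show "\<delta> j - 3 * \<eta> \<le> real (card (inner j)) / real N"
    using N_pos by (simp add: field_simps)
  show fin: "finite (inner j)" unfolding inner_def by (rule card_int_between_le(1)[OF le])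
  \<comment> \<open>A shrunk interval fits into one period, which is what makes its smoothed
    indicator at most 1. The form \<open>0 + int N\<close> matches the shape expected by
    \<open>smoothed_le_1\<close>.\<close>
  show sub: "inner j \<subseteq> {0..<0 + int N}"
  proof
    fix s assume s: "s \<in> inner j"
    have "0 \<le> real N * (c j + \<eta>)" using c(1)[OF assms] eta_pos by simp
    moreover have "real N * (c j + \<delta> j - \<eta>) \<le> real N * 1"
      using c(2)[OF assms] eta_pos N_pos by (intro mult_left_mono) auto
    ultimately have "0 < real_of_int s" "real_of_int s < real N"
      using s unfolding inner_def by auto
    thus "s \<in> {0..<0 + int N}" by simp
  qed
  have "card (inner j) \<le> card {0..<0 + int N}" by (rule card_mono[OF _ sub]) simp
  thus "real (card (inner j)) / real N \<le> 1" using N_pos by simp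
qed

lemma smoothed_outer_ge:
  assumes "X \<in> box" "j \<in> J"
  shows "smoothed a d N (outer j) (X (int (p j))) \<ge> 1 - \<kappa>"
proof -
  have ang: "c j < angle X j" "angle X j < c j + \<delta> j" using assms by (auto simp: box_def)
  have "smoothed a d N (outer j) (cis (2 * pi * angle X j)) \<ge> 1 - \<kappa>"
  proof (rule smoothed_ge[OF norm N(1) eta kernel kappa(1) card_outer(2)[OF assms(2)]])
    fix s assume "\<bar>angle X j - of_int s / real N\<bar> < \<eta>"
    hence "c j - \<eta> < of_int s / real N" "of_int s / real N < c j + \<delta> j + \<eta>"
      using ang by linarith+
    thus "s \<in> outer j" using N_pos by (simp add: outer_def field_simps)
  qed
  thus ?thesis using char_eq_cis[of X j] assms box_subset by auto
qed

lemma smoothed_inner_le: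
  assumes "X \<in> chars" "j \<in> J" "angle X j \<notin> {c j<..<c j + \<delta> j}"
  shows "smoothed a d N (inner j) (X (int (p j))) \<le> \<kappa>"
proof -
  have "smoothed a d N (inner j) (cis (2 * pi * angle X j)) \<le> \<kappa> * (real (card (inner j)) / real N)"
  proof (rule smoothed_le_card[OF kernel])
    fix s assume "s \<in> inner j"
    hence s: "c j + \<eta> < of_int s / real N" "of_int s / real N < c j + \<delta> j - \<eta>"
      using N_pos by (auto simp: inner_def field_simps)
    \<comment> \<open>Wrapping around the circle does no harm: the points \<open>s / N\<close> lie
      strictly between \<open>\<eta>\<close> and \<open>1 - \<eta>\<close>, hence differ from any
      angle in [0,1) by less than \<open>1 - \<eta>\<close>.\<close>
    have "0 \<le> angle X j" "angle X j < 1" by (simp_all add: frac_lt_1)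
    moreover have "angle X j \<le> c j \<or> c j + \<delta> j \<le> angle X j" using assms(3) by auto
    ultimately show "\<eta> \<le> \<bar>angle X j - of_int s / real N\<bar> \<and> \<bar>angle X j - of_int s / real N\<bar> \<le> 1 - \<eta>"
      using s c[OF assms(2)] by linarith
  qed
  also have "\<dots> \<le> \<kappa> * 1" by (intro mult_left_mono card_inner kappa assms)
  finally show ?thesis using char_eq_cis[OF assms(1,2)] by simp
qed

lemma smoothed_inner_le_1:
  assumes "X \<in> chars" "j \<in> J"
  shows "smoothed a d N (inner j) (X (int (p j))) \<le> 1"
  by (rule smoothed_le_1[OF norm N(1) norm_char[OF assms] card_inner(3)[OF assms(2)]])

text \<open>Subsets of \<open>J\<close> are allowed because the error terms of the lower bound omit
  one coordinate. The product of prime powers over a subset divides the full one, so it stays below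
  \<open>q\<close>.\<close>

lemma sum_prod_smoothed:
  assumes "J' \<subseteq> J"
  shows "(\<Sum>X\<in>chars. \<Prod>j\<in>J'. smoothed a d N (A j) (X (int (p j)))) =
    real (q - 1) * (\<Prod>j\<in>J'. real (card (A j)) / real N)"
  unfolding chars_def
proof (rule sum_characters_prod_smoothed[OF q])
  show "finite J'" "inj_on p J'" using assms J finite_subset inj_on_subset by blast+
  show "prime (p j)" "p j < q" if "j \<in> J'" for j using that assms J small by auto
  have "(\<Prod>j\<in>J'. p j ^ d) \<le> (\<Prod>j\<in>J. p j ^ d)"
  proof (rule dvd_imp_le)
    show "(\<Prod>j\<in>J'. p j ^ d) dvd (\<Prod>j\<in>J. p j ^ d)"
      using prod_dvd_prod_subset[OF J(1) assms] .
    show "0 < (\<Prod>j\<in>J. p j ^ d)" using J(3) prime_gt_0_nat by (intro prod_pos) auto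
  qed
  thus "(\<Prod>j\<in>J'. p j ^ d) < q" using small(2) by linarith
qed (rule norm)

text \<open>On the box every factor is at least \<open>1 - \<kappa>\<close>. By nonnegativity the
  sum may be extended to all characters, where it is known exactly.\<close>

theorem card_box_le:
  "real (card box) * (1 - \<kappa>) ^ card J \<le> real (q - 1) * (\<Prod>j\<in>J. \<delta> j + 3 * \<eta>)"
proof -
  have "real (card box) * (1 - \<kappa>) ^ card J = (\<Sum>X\<in>box. \<Prod>j\<in>J. 1 - \<kappa>)" by simp
  also have "\<dots> \<le> (\<Sum>X\<in>box. \<Prod>j\<in>J. smoothed a d N (outer j) (X (int (p j))))"
    using kappa by (intro sum_mono prod_mono) (auto intro: smoothed_outer_ge)
  also have "\<dots> \<le> (\<Sum>X\<in>chars. \<Prod>j\<in>J. smoothed a d N (outer j) (X (int (p j))))"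
    by (intro sum_mono2 finite_chars box_subset prod_nonneg smoothed_nonneg)
  also have "\<dots> = real (q - 1) * (\<Prod>j\<in>J. real (card (outer j)) / real N)"
    by (rule sum_prod_smoothed) simp
  also have "\<dots> \<le> real (q - 1) * (\<Prod>j\<in>J. \<delta> j + 3 * \<eta>)"
    by (intro mult_left_mono prod_mono) (auto intro: card_outer)
  finally show ?thesis .
qed

text \<open>Products of minorants of indicator functions are minorants only up to an error: where some
  coordinate lies outside its interval, the corresponding factor is at most \<open>\<kappa>\<close>, and the
  other factors are kept so that the error still has the right order of magnitude.\<close>

theorem card_box_ge:
  assumes "(\<Sum>j\<in>J. \<kappa> / (\<delta> j - 3 * \<eta>)) \<le> 1"
  shows "real (card box) \<ge>
    real (q - 1) * (\<Prod>j\<in>J. \<delta> j - 3 * \<eta>) * (1 - (\<Sum>j\<in>J. \<kappa> / (\<delta> j - 3 * \<eta>)))"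
proof -
  define G where "G = (\<lambda>X j. smoothed a d N (inner j) (X (int (p j))))"
  define \<beta> where "\<beta> = (\<lambda>j. real (card (inner j)) / real N)"
  have G0: "G X j \<ge> 0" for X j by (simp add: G_def smoothed_nonneg)
  have \<beta>: "\<beta> j \<ge> \<delta> j - 3 * \<eta>" "\<delta> j - 3 * \<eta> > 0" if "j \<in> J" for j
    using card_inner(1)[OF that] delta[OF that] by (auto simp: \<beta>_def)
  have pt: "(\<Prod>j\<in>J. G X j) \<le> (if X \<in> box then 1 else 0) + (\<Sum>j\<in>J. \<kappa> * (\<Prod>i\<in>J - {j}. G X i))"
    if X: "X \<in> chars" for X
  proof (cases "X \<in> box")
    case True
    have "(\<Prod>j\<in>J. G X j) \<le> 1"
      unfolding G_def using X by (intro prod_le_1) (auto intro: smoothed_nonneg smoothed_inner_le_1)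
    moreover have "(\<Sum>j\<in>J. \<kappa> * (\<Prod>i\<in>J - {j}. G X i)) \<ge> 0"
      by (intro sum_nonneg mult_nonneg_nonneg kappa prod_nonneg G0)
    ultimately show ?thesis using True by simp
  next
    case False
    then obtain j where j: "j \<in> J" "angle X j \<notin> {c j<..<c j + \<delta> j}"
      using X by (auto simp: box_def chars_def)
    have "(\<Prod>j\<in>J. G X j) = G X j * (\<Prod>i\<in>J - {j}. G X i)"
      by (rule prod.remove[OF J(1) j(1)])
    also have "\<dots> \<le> \<kappa> * (\<Prod>i\<in>J - {j}. G X i)"
      using smoothed_inner_le[OF X j] by (intro mult_right_mono prod_nonneg G0) (simp add: G_def)
    also have "\<dots> \<le> (\<Sum>j\<in>J. \<kappa> * (\<Prod>i\<in>J - {j}. G X i))"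
      by (rule member_le_sum[OF j(1)]) (auto intro!: mult_nonneg_nonneg kappa prod_nonneg G0 J)
    finally show ?thesis using False by simp
  qed
  have "real (q - 1) * (\<Prod>j\<in>J. \<beta> j) = (\<Sum>X\<in>chars. \<Prod>j\<in>J. G X j)"
    unfolding G_def \<beta>_def by (rule sum_prod_smoothed[symmetric]) simp
  also have "\<dots> \<le> (\<Sum>X\<in>chars. (if X \<in> box then 1 else 0) + (\<Sum>j\<in>J. \<kappa> * (\<Prod>i\<in>J - {j}. G X i)))"
    by (intro sum_mono pt)
  also have "\<dots> = real (card box) + (\<Sum>X\<in>chars. \<Sum>j\<in>J. \<kappa> * (\<Prod>i\<in>J - {j}. G X i))"
    using finite_chars box_subset by (simp add: sum.distrib Int_absorb1 flip: sum.inter_restrict)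
  also have "(\<Sum>X\<in>chars. \<Sum>j\<in>J. \<kappa> * (\<Prod>i\<in>J - {j}. G X i)) =
      (\<Sum>j\<in>J. \<kappa> * (\<Sum>X\<in>chars. \<Prod>i\<in>J - {j}. G X i))"
    by (subst sum.swap) (simp add: sum_distrib_left)
  also have "\<dots> = (\<Sum>j\<in>J. \<kappa> * (real (q - 1) * (\<Prod>i\<in>J - {j}. \<beta> i)))"
    unfolding G_def \<beta>_def by (subst sum_prod_smoothed) auto
  also have "\<dots> = (\<Sum>j\<in>J. real (q - 1) * (\<Prod>i\<in>J. \<beta> i) * (\<kappa> / \<beta> j))"
  proof (rule sum.cong)
    fix j assume j: "j \<in> J"
    have "(\<Prod>i\<in>J. \<beta> i) = \<beta> j * (\<Prod>i\<in>J - {j}. \<beta> i)" by (rule prod.remove[OF J(1) j])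
    thus "\<kappa> * (real (q - 1) * (\<Prod>i\<in>J - {j}. \<beta> i)) = real (q - 1) * (\<Prod>i\<in>J. \<beta> i) * (\<kappa> / \<beta> j)"
      using \<beta>[OF j] by simp
  qed simp
  finally have ge: "real (q - 1) * (\<Prod>j\<in>J. \<beta> j) * (1 - (\<Sum>j\<in>J. \<kappa> / \<beta> j)) \<le> real (card box)"
    by (simp add: right_diff_distrib sum_distrib_left)
  \<comment> \<open>The exact densities \<open>\<beta> j\<close> are replaced by their lower bounds,
    first in the product and then in the error sum. The first replacement needs the last factor to
    be nonnegative, which is the assumption.\<close>
  have "real (q - 1) * (\<Prod>j\<in>J. \<delta> j - 3 * \<eta>) * (1 - (\<Sum>j\<in>J. \<kappa> / (\<delta> j - 3 * \<eta>))) \<le>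
      real (q - 1) * (\<Prod>j\<in>J. \<beta> j) * (1 - (\<Sum>j\<in>J. \<kappa> / (\<delta> j - 3 * \<eta>)))"
    using \<beta> assms by (intro mult_right_mono mult_left_mono prod_mono) (auto intro: less_imp_le)
  also have "\<dots> \<le> real (q - 1) * (\<Prod>j\<in>J. \<beta> j) * (1 - (\<Sum>j\<in>J. \<kappa> / \<beta> j))"
  proof (intro mult_left_mono diff_left_mono sum_mono divide_left_mono kappa)
    show "0 \<le> real (q - 1) * (\<Prod>j\<in>J. \<beta> j)" 
      by (intro mult_nonneg_nonneg prod_nonneg) (simp_all add: \<beta>_def)
    fix j assume j: "j \<in> J"
    show "0 < \<beta> j * (\<delta> j - 3 * \<eta>)" using \<beta>[OF j] by (intro mult_pos_pos) linarith+
  qed (use \<beta> in auto)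
  finally show ?thesis using ge by linarith
qed

text \<open>With \<open>k = card J\<close>, both smallness conditions allow a relative error of
  \<open>e / k\<close> per coordinate. Changed lengths cost
  \<open>(1 + e / k) ^ k \<le> exp e\<close> above and, by Bernoulli, a factor \<open>1 - e\<close>
  below. The smoothing error \<open>\<kappa>\<close> costs one more factor \<open>1 - e\<close> on
  each side.\<close>

theorem card_box_ratio:
  assumes e: "0 < e" "e < 1"
    and small_eta: "\<And>j. j \<in> J \<Longrightarrow> real (card J) * (3 * \<eta>) \<le> e * \<delta> j"
    and small_kappa: "\<And>j. j \<in> J \<Longrightarrow> real (card J) * \<kappa> \<le> e * (\<delta> j - 3 * \<eta>)"
  shows "real (card box) / (real (q - 1) * (\<Prod>j\<in>J. \<delta> j)) \<le> exp e / (1 - e)"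
    and "real (card box) / (real (q - 1) * (\<Prod>j\<in>J. \<delta> j)) \<ge> (1 - e)\<^sup>2"
proof -
  define k where "k = real (card J)"
  have kJ: "k \<ge> 1" if "j \<in> J" for j
  proof -
    have "card J > 0" using that J(1) by (auto simp: card_gt_0_iff)
    thus ?thesis by (simp add: k_def)
  qed
  have d0: "\<delta> j > 0" if "j \<in> J" for j using delta[OF that] eta_pos by linarith
  have P: "(\<Prod>j\<in>J. \<delta> j) > 0" by (intro prod_pos) (use d0 in auto)
  have "real (q - 1) > 0" using prime_gt_1_nat[OF q] by simp
  hence M: "real (q - 1) * (\<Prod>j\<in>J. \<delta> j) > 0" using P by simp
  have eta_le: "3 * \<eta> \<le> e / k * \<delta> j" if "j \<in> J" for j
    using small_eta[OF that, folded k_def] kJ[OF that] by (simp add: field_simps)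
  have kap: "k * \<kappa> \<le> e"
  proof (cases "J = {}")
    case False
    then obtain j where j: "j \<in> J" by blast
    have "\<delta> j - 3 * \<eta> \<le> 1" using c[OF j] eta_pos by linarith
    hence "e * (\<delta> j - 3 * \<eta>) \<le> e * 1" using e by (intro mult_left_mono) auto
    thus ?thesis using small_kappa[OF j] by (simp add: k_def)
  qed (use e in \<open>simp add: k_def\<close>)
  have "(1 - e) * real (card box) \<le> (1 - \<kappa>) ^ card J * real (card box)"
  proof (intro mult_right_mono)
    have "1 + real (card J) * (- \<kappa>) \<le> (1 + (- \<kappa>)) ^ card J"
      using kappa by (intro Bernoulli_inequality) auto
    thus "1 - e \<le> (1 - \<kappa>) ^ card J" using kap by (simp add: k_def)
  qed simp
  also have "\<dots> \<le> real (q - 1) * (\<Prod>j\<in>J. \<delta> j + 3 * \<eta>)" using card_box_le by (simp add: mult.commute)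
  also have "(\<Prod>j\<in>J. \<delta> j + 3 * \<eta>) \<le> (\<Prod>j\<in>J. \<delta> j * exp (e / k))"
  proof (intro prod_mono conjI)
    fix j assume j: "j \<in> J"
    show "0 \<le> \<delta> j + 3 * \<eta>" using d0[OF j] eta_pos by simp
    have "\<delta> j + 3 * \<eta> \<le> \<delta> j * (1 + e / k)" using eta_le[OF j] by (simp add: algebra_simps)
    also have "\<dots> \<le> \<delta> j * exp (e / k)"
      using d0[OF j] exp_ge_add_one_self[of "e / k"] by (intro mult_left_mono) auto
    finally show "\<delta> j + 3 * \<eta> \<le> \<delta> j * exp (e / k)" .
  qed
  also have "(\<Prod>j\<in>J. \<delta> j * exp (e / k)) = (\<Prod>j\<in>J. \<delta> j) * exp (k * (e / k))"
    unfolding k_def exp_of_nat_mult by (simp add: prod.distrib)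
  \<comment> \<open>For empty \<open>J\<close> the quotient \<open>e / k\<close> is 0 by convention,
    so \<open>k * (e / k) \<le> e\<close> holds there too.\<close>
  also have "\<dots> \<le> (\<Prod>j\<in>J. \<delta> j) * exp e"
    using P e by (intro mult_left_mono) (auto simp: k_def)
  finally have "(1 - e) * real (card box) \<le> real (q - 1) * ((\<Prod>j\<in>J. \<delta> j) * exp e)"
    by (simp add: mult_left_mono)
  thus "real (card box) / (real (q - 1) * (\<Prod>j\<in>J. \<delta> j)) \<le> exp e / (1 - e)"
    unfolding pos_divide_le_eq[OF M] using e by (simp add: pos_le_divide_eq mult_ac)
  have sum: "(\<Sum>j\<in>J. \<kappa> / (\<delta> j - 3 * \<eta>)) \<le> e"
  proof -
    have "(\<Sum>j\<in>J. \<kappa> / (\<delta> j - 3 * \<eta>)) \<le> (\<Sum>j\<in>J. e / k)"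
    proof (rule sum_mono)
      fix j assume j: "j \<in> J"
      show "\<kappa> / (\<delta> j - 3 * \<eta>) \<le> e / k"
        using small_kappa[OF j, folded k_def] kJ[OF j] delta[OF j] by (simp add: field_simps)
    qed
    also have "\<dots> \<le> e" using e by (simp add: k_def)
    finally show ?thesis .
  qed
  have "(1 - e)\<^sup>2 * (\<Prod>j\<in>J. \<delta> j) \<le> (\<Prod>j\<in>J. \<delta> j - 3 * \<eta>) * (1 - e)"
  proof -
    have "1 - e \<le> (1 - e / k) ^ card J"
    proof (cases "J = {}")
      case False
      then obtain j where "j \<in> J" by blast
      hence k1: "k \<ge> 1" by (rule kJ)
      hence "e / k \<le> 1" using e by (simp add: field_simps)
      hence "1 + real (card J) * (- (e / k)) \<le> (1 + (- (e / k))) ^ card J"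
        by (intro Bernoulli_inequality) auto
      thus ?thesis using k1 by (simp add: k_def)
    qed (use e in auto)
    hence "(1 - e) * (\<Prod>j\<in>J. \<delta> j) \<le> (1 - e / k) ^ card J * (\<Prod>j\<in>J. \<delta> j)"
      using P by (intro mult_right_mono) auto
    also have "\<dots> = (\<Prod>j\<in>J. (1 - e / k) * \<delta> j)" by (simp add: prod.distrib)
    also have "\<dots> \<le> (\<Prod>j\<in>J. \<delta> j - 3 * \<eta>)"
    proof (intro prod_mono conjI)
      fix j assume j: "j \<in> J"
      have "e / k \<le> 1" using e kJ[OF j] by (simp add: field_simps)
      thus "0 \<le> (1 - e / k) * \<delta> j" using d0[OF j] by simp
      show "(1 - e / k) * \<delta> j \<le> \<delta> j - 3 * \<eta>" using eta_le[OF j] by (simp add: algebra_simps)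
    qed
    finally have "(1 - e) * (\<Prod>j\<in>J. \<delta> j) * (1 - e) \<le> (\<Prod>j\<in>J. \<delta> j - 3 * \<eta>) * (1 - e)"
      using e by (intro mult_right_mono) auto
    thus ?thesis by (simp add: power2_eq_square mult_ac)
  qed
  also have "\<dots> \<le> (\<Prod>j\<in>J. \<delta> j - 3 * \<eta>) * (1 - (\<Sum>j\<in>J. \<kappa> / (\<delta> j - 3 * \<eta>)))"
    using sum delta by (intro mult_left_mono prod_nonneg) (auto intro: less_imp_le)
  finally have "real (q - 1) * ((1 - e)\<^sup>2 * (\<Prod>j\<in>J. \<delta> j)) \<le> real (q - 1) *
      ((\<Prod>j\<in>J. \<delta> j - 3 * \<eta>) * (1 - (\<Sum>j\<in>J. \<kappa> / (\<delta> j - 3 * \<eta>))))"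
    by (rule mult_left_mono) simp
  also have "\<dots> \<le> real (card box)" using card_box_ge sum e by (simp add: mult.assoc)
  finally show "real (card box) / (real (q - 1) * (\<Prod>j\<in>J. \<delta> j)) \<ge> (1 - e)\<^sup>2"
    unfolding pos_le_divide_eq[OF M] by (simp add: mult_ac)
qed

end

section \<open>The choice of parameters\<close>

lemma prime_nth_prime: "prime (nth_prime j)"
  using enumerate_in_set[OF primes_infinite] by (simp add: nth_prime_def)

lemma inj_on_nth_prime: "inj_on nth_prime {1..k}"
proof (rule inj_onI)
  fix i j assume ij: "i \<in> {1..k}" "j \<in> {1..k}" "nth_prime i = nth_prime j"
  hence "i - 1 = j - 1"
    using strict_mono_enumerate[OF primes_infinite] unfolding nth_prime_def
    by (metis strict_mono_eq)
  thus "i = j" using ij by auto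
qed

text \<open>If the \<open>j\<close>-th prime exceeded \<open>y\<close>, all primes up to
  \<open>y\<close> would be among the \<open>j - 1\<close> earlier ones, so \<open>j\<close> would
  exceed \<open>prime_count y\<close>.\<close>

lemma nth_prime_le:
  assumes "j \<in> {1..prime_count y}"
  shows "real (nth_prime j) \<le> y"
proof (rule ccontr)
  assume gt: "\<not> real (nth_prime j) \<le> y"
  have "{p :: nat. prime p \<and> real p \<le> y} \<subseteq> enumerate {p. prime p} ` {..<j - 1}"
  proof
    fix p assume p: "p \<in> {p :: nat. prime p \<and> real p \<le> y}"
    then obtain i where i: "p = enumerate {p. prime p} i"
      using enumerate_Ex[OF primes_infinite, of p] by auto
    have "real (enumerate {p. prime p} i) < real (enumerate {p. prime p} (j - 1))"
      using p gt i by (simp add: nth_prime_def)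
    hence "i < j - 1"
      using strict_mono_less[OF strict_mono_enumerate[OF primes_infinite]] by simp
    thus "p \<in> enumerate {p. prime p} ` {..<j - 1}" using i by blast
  qed
  hence "prime_count y \<le> card (enumerate {p :: nat. prime p} ` {..<j - 1})"
    unfolding prime_count_def by (intro card_mono) auto
  also have "\<dots> \<le> j - 1" using card_image_le[of "{..<j - 1}"] by simp
  finally show False using assms by auto
qed

lemma prime_count_le:
  assumes "y \<ge> 0"
  shows "real (prime_count y) \<le> y"
proof -
  have "{p :: nat. prime p \<and> real p \<le> y} \<subseteq> {1..nat \<lfloor>y\<rfloor>}"
    using prime_gt_0_nat by (auto simp: le_nat_floor Suc_le_eq)
  hence "prime_count y \<le> card {1..nat \<lfloor>y\<rfloor>}"
    unfolding prime_count_def by (intro card_mono) auto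
  thus ?thesis using assms by simp linarith
qed

text \<open>The error \<open>e\<close> comes from the lengths: there are at most
  \<open>sqrt L / l\<^sup>2\<close> primes, \<open>3 * \<eta>\<close> is at most
  \<open>12 / sqrt L\<close>, and dividing by an interval length costs less than
  \<open>l powr (5/3)\<close>. The degree, about \<open>l * sqrt L\<close>, is small enough for the
  products of prime powers to stay below \<open>q\<close> and large enough to make
  \<open>\<kappa>\<close> negligible.\<close>

lemma character_count_ratio:
  fixes q :: nat and y :: real and I :: "nat \<Rightarrow> real set" and \<delta> :: "nat \<Rightarrow> real"
  defines "L \<equiv> ln (real q)"
  defines "l \<equiv> ln L"
  defines "e \<equiv> 12 * l powr (-1/3)"
  defines "M \<equiv> real (totient q) * (\<Prod>j\<in>{1..prime_count y}. \<delta> j)"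
  assumes q: "prime q" and large: "64 \<le> L" "2 \<le> l" "e \<le> 1/2" "4 * l \<le> e * L"
    and y: "2 < y" "y \<le> sqrt L / l\<^sup>2"
    and I: "\<And>j. j \<in> {1..prime_count y} \<Longrightarrow>
      open_interval_of_length (I j) (\<delta> j) \<and> I j \<subseteq> {0<..<1} \<and> l powr (-5/3) < \<delta> j"
  shows "(1 - e)\<^sup>2 \<le> real (character_count q y I) / M"
    and "real (character_count q y I) / M \<le> exp e / (1 - e)"
proof -
  define J where "J = {1..prime_count y}"
  define k where "k = real (card J)"
  define H where "H = nat \<lfloor>sqrt L\<rfloor>"
  define r where "r = nat \<lceil>l\<rceil>"
  define d where "d = r * (H - 1)"
  \<comment> \<open>Exceeding \<open>d\<close> makes the discretisation exact, and being at least
    \<open>H\<close> gives \<open>1 / N \<le> \<eta>\<close>.\<close>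
  define N where "N = d + H"
  \<comment> \<open>With this choice \<open>2 * \<eta> * H = 4\<close>, so the kernel bound becomes
    the \<open>\<kappa>\<close> defined next.\<close>
  define \<eta> where "\<eta> = 2 / real H"
  define \<kappa> where "\<kappa> = real (d + 1) / 4 ^ (2 * r)"
  define s where "s = sqrt L"
  have s: "s\<^sup>2 = L" "8 \<le> s" "s \<le> L"
  proof -
    show s2: "s\<^sup>2 = L" using large by (simp add: s_def)
    show s8: "8 \<le> s" using large real_le_rsqrt[of 8 L] by (simp add: s_def)
    have "s * 1 \<le> s * s" using s8 by (intro mult_left_mono) auto
    thus "s \<le> L" using s2 by (simp add: power2_eq_square)
  qed
  have l: "4 \<le> l\<^sup>2" using power_mono[of 2 l 2] large by simp
  have H: "real H \<le> s" "s / 2 \<le> real H" "H > 0"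
  proof -
    have "real H \<le> s \<and> s < real H + 1" using s unfolding H_def s_def by linarith
    thus "real H \<le> s" "s / 2 \<le> real H" "H > 0" using s by linarith+
  qed
  have r: "l \<le> real r" "real r \<le> l + 1" using large unfolding r_def by linarith+
  hence r0: "r > 0" using large by linarith
  have d1: "real (d + 1) \<le> (l + 1) * s"
  proof -
    have "d + 1 \<le> r * H" using r0 H(3) unfolding d_def by (cases H; cases r) auto
    hence "real (d + 1) \<le> real r * real H" by (simp flip: of_nat_mult)
    also have "\<dots> \<le> (l + 1) * s" using r H large by (intro mult_mono) auto
    finally show ?thesis .
  qed
  have ys: "y \<le> s / l\<^sup>2" using y by (simp add: s_def)
  have "s / l\<^sup>2 \<le> s / 1" using s l by (intro divide_left_mono) auto
  hence y_le_s: "y \<le> s" using ys by simp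
  have k: "k \<le> y" using prime_count_le[of y] y by (simp add: k_def J_def)
  have L_q: "L < real q" unfolding L_def using prime_gt_0_nat[OF q] by (intro ln_less_self) simp
  have le_y: "real (nth_prime j) \<le> y" if "j \<in> J" for j
    using nth_prime_le that by (simp add: J_def)
  have ex: "\<exists>a. j \<in> J \<longrightarrow> I j = {a<..<a + \<delta> j}" for j
    using I[of j] by (auto simp: open_interval_of_length_def J_def)
  obtain c where I_eq: "\<And>j. j \<in> J \<Longrightarrow> I j = {c j<..<c j + \<delta> j}"
    using choice[of "\<lambda>j a. j \<in> J \<longrightarrow> I j = {a<..<a + \<delta> j}"] ex by blast
  have \<delta>: "l powr (-5/3) < \<delta> j" "0 < \<delta> j" "0 \<le> c j" "c j + \<delta> j \<le> 1" if "j \<in> J" for j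
  proof -
    show "l powr (-5/3) < \<delta> j" using I that by (simp add: J_def)
    show \<delta>0: "0 < \<delta> j" using I that by (simp add: J_def open_interval_of_length_def)
    have "{c j<..<c j + \<delta> j} \<subseteq> {0<..<1}" using I I_eq[OF that] that by (auto simp: J_def)
    thus "0 \<le> c j" "c j + \<delta> j \<le> 1" using \<delta>0 by (auto simp: greaterThanLessThan_subseteq_greaterThanLessThan)
  qed
  have e0: "e > 0" using large by (simp add: e_def)
  have eta: "\<eta> \<le> 4 / s" "\<eta> \<le> 1/2" "\<eta> > 0" "1 / real N \<le> \<eta>"
  proof -
    have "\<eta> \<le> 2 / (s / 2)" unfolding \<eta>_def using H s by (intro divide_left_mono) auto
    thus "\<eta> \<le> 4 / s" by simp
    also have "\<dots> \<le> 4 / 8" using s by (intro divide_left_mono) auto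
    finally show "\<eta> \<le> 1/2" by simp
    show "\<eta> > 0" using H by (simp add: \<eta>_def)
    have "1 / real N \<le> 1 / real H" unfolding N_def using H by (intro divide_left_mono) auto
    also have "\<dots> \<le> \<eta>" unfolding \<eta>_def by (intro divide_right_mono) auto
    finally show "1 / real N \<le> \<eta>" .
  qed
  have kappa: "0 \<le> \<kappa>" "\<kappa> \<le> (l + 1) * s / L\<^sup>2"
  proof -
    show "0 \<le> \<kappa>" by (simp add: \<kappa>_def)
    \<comment> \<open>As \<open>r \<ge> l\<close> and 4 exceeds \<open>exp 1\<close>, the
      denominator of \<open>\<kappa>\<close> is at least \<open>L\<^sup>2\<close>.\<close>
    have "L = exp l" unfolding l_def using large by simp
    also have "\<dots> \<le> exp (real r)" using r by simp
    also have "\<dots> = exp 1 ^ r" using exp_of_nat_mult[of r "1::real"] by simp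
    also have "\<dots> \<le> 4 ^ r" using exp_le by (intro power_mono) auto
    finally have "L\<^sup>2 \<le> (4 ^ r)\<^sup>2" using large by (intro power_mono) auto
    hence "L\<^sup>2 \<le> 4 ^ (2 * r)" by (simp add: power_mult[symmetric] mult.commute)
    thus "\<kappa> \<le> (l + 1) * s / L\<^sup>2" unfolding \<kappa>_def
      using d1 large s by (intro frac_le) auto
  qed
  have kl: "k \<le> s / l\<^sup>2" using k ys by simp
  \<comment> \<open>The lower bound for the lengths uses up \<open>l powr (-5/3)\<close> of the
    available \<open>1 / l\<^sup>2\<close>; what remains is \<open>e\<close> up to its constant
    12.\<close>
  have powr_l: "l powr (-1/3) * l powr (-5/3) = 1 / l\<^sup>2"
    using large by (simp add: powr_minus_divide powr_realpow flip: powr_add)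
  have small_eta: "k * (3 * \<eta>) \<le> e * \<delta> j" if "j \<in> J" for j
  proof -
    have "k * (3 * \<eta>) \<le> s / l\<^sup>2 * (3 * (4 / s))"
      using kl eta s by (intro mult_mono) (auto simp: k_def)
    also have "\<dots> = 12 / l\<^sup>2" using s by simp
    also have "\<dots> = e * l powr (-5/3)" using powr_l by (simp add: e_def)
    also have "\<dots> \<le> e * \<delta> j" using \<delta>[OF that] e0 by (intro mult_left_mono) auto
    finally show ?thesis .
  qed
  have k1: "k \<ge> 1" if "j \<in> J" for j
  proof -
    have "card J > 0" using that by (auto simp: card_gt_0_iff J_def)
    thus ?thesis by (simp add: k_def)
  qed
  have half: "3 * \<eta> \<le> \<delta> j / 2" if "j \<in> J" for j
  proof -
    have "1 * (3 * \<eta>) \<le> k * (3 * \<eta>)" using k1[OF that] eta by (intro mult_right_mono) auto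
    also have "\<dots> \<le> e * \<delta> j" by (rule small_eta[OF that])
    also have "\<dots> \<le> 1/2 * \<delta> j" using \<delta>[OF that] large by (intro mult_right_mono) auto
    finally show ?thesis by simp
  qed
  have small_kappa: "k * \<kappa> \<le> e * (\<delta> j - 3 * \<eta>)" if "j \<in> J" for j
  proof -
    have "k * \<kappa> \<le> s / l\<^sup>2 * ((l + 1) * s / L\<^sup>2)"
      using kl kappa s by (intro mult_mono) (auto simp: k_def)
    also have "\<dots> = (l + 1) / (l\<^sup>2 * L)"
      using s large by (simp add: power2_eq_square field_simps flip: s(1))
    also have "\<dots> \<le> e / (2 * l\<^sup>2)"
    proof -
      have "2 * (l + 1) \<le> 4 * l" using large(2) by simp
      also have "\<dots> \<le> e * L" by (rule large(4))
      finally have "2 * (l + 1) / (2 * l\<^sup>2 * L) \<le> e * L / (2 * l\<^sup>2 * L)"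
        using large by (intro divide_right_mono) auto
      also have "2 * (l + 1) / (2 * l\<^sup>2 * L) = (l + 1) / (l\<^sup>2 * L)"
        by (simp only: mult.assoc mult_divide_mult_cancel_left_if) simp
      also have "e * L / (2 * l\<^sup>2 * L) = e / (2 * l\<^sup>2)" using large by simp
      finally show ?thesis .
    qed
    also have "\<dots> \<le> e * (\<delta> j - 3 * \<eta>)"
    proof -
      \<comment> \<open>Since \<open>3 * \<eta>\<close> is at most half of
        \<open>\<delta> j\<close>, a crude bound \<open>\<delta> j \<ge> 1 / l\<^sup>2\<close> is
        enough here: \<open>\<kappa>\<close> has a factor \<open>1 / L\<close> to spare.\<close>
      have "1 / l\<^sup>2 = l powr (-2)" using large by (simp add: powr_minus_divide powr_realpow)
      also have "\<dots> \<le> l powr (-5/3)" using large by (intro powr_mono) auto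
      also have "\<dots> \<le> \<delta> j" using \<delta>[OF that] by simp
      finally have "1 / (2 * l\<^sup>2) \<le> \<delta> j - 3 * \<eta>" using half[OF that] by simp
      hence "e * (1 / (2 * l\<^sup>2)) \<le> e * (\<delta> j - 3 * \<eta>)" using e0 by (intro mult_left_mono) auto
      thus ?thesis by simp
    qed
    finally show ?thesis .
  qed
  obtain a :: "nat \<Rightarrow> complex" where a: "(\<Sum>i\<le>d. (cmod (a i))\<^sup>2) = 1"
    "\<And>u. \<eta> \<le> \<bar>u\<bar> \<Longrightarrow> \<bar>u\<bar> \<le> 1 - \<eta> \<Longrightarrow> (cmod (\<Sum>i\<le>d. a i * cis (2 * pi * u) ^ i))\<^sup>2 \<le> \<kappa>"
  proof (rule jackson_kernel[OF H(3) eta(3), of r])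
    fix a assume a: "(\<Sum>i\<le>r * (H - 1). (cmod (a i))\<^sup>2) = 1"
      "\<And>u. \<eta> \<le> \<bar>u\<bar> \<Longrightarrow> \<bar>u\<bar> \<le> 1 - \<eta> \<Longrightarrow>
       (cmod (\<Sum>i\<le>r * (H - 1). a i * cis (2 * pi * u) ^ i))\<^sup>2
         \<le> real (r * (H - 1) + 1) / (2 * \<eta> * real H) ^ (2 * r)"
    have eH: "2 * \<eta> * real H = 4" using H by (simp add: \<eta>_def)
    show thesis
      using a unfolding eH d_def[symmetric] \<kappa>_def[symmetric] by (rule that)
  qed
  \<comment> \<open>The bounds \<open>s / l\<^sup>2\<close> for the number of primes,
    \<open>(l + 1) * s\<close> for the degree and \<open>l / 2\<close> for \<open>ln y\<close>
    multiply to \<open>L * (l + 1) / (2 * l)\<close>, which is below \<open>L\<close> because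
    \<open>l > 1\<close>.\<close>
  have prod_small: "(\<Prod>j\<in>J. nth_prime j ^ d) < q"
  proof -
    have "(\<Prod>j\<in>J. real (nth_prime j) ^ d) \<le> (\<Prod>j\<in>J. y ^ d)"
      using le_y by (intro prod_mono) (auto intro: power_mono)
    also have "\<dots> = exp (k * real d * ln y)"
      using y by (simp add: k_def exp_of_nat_mult mult.assoc flip: power_mult)
    also have "\<dots> < exp L"
    proof -
      have "ln y \<le> ln s" using y_le_s y by simp
      also have "ln s = l / 2" unfolding s_def l_def using large by (simp add: ln_sqrt)
      finally have lny: "ln y \<le> l / 2" .
      have "k * real d * ln y \<le> s / l\<^sup>2 * ((l + 1) * s) * (l / 2)"
        using kl d1 lny y s large by (intro mult_mono) (auto simp: k_def)
      also have "\<dots> = L * ((l + 1) / (2 * l))"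
        using large by (simp add: power2_eq_square field_simps flip: s(1))
      also have "\<dots> < L * 1" using large by (intro mult_strict_left_mono) auto
      finally show ?thesis by simp
    qed
    also have "\<dots> = real q" unfolding L_def using prime_gt_0_nat[OF q] by simp
    finally have "real (\<Prod>j\<in>J. nth_prime j ^ d) < real q" by simp
    thus ?thesis by (simp only: of_nat_less_iff)
  qed
  interpret character_box q J nth_prime c \<delta> a d N \<eta> \<kappa>
  proof
    show "inj_on nth_prime J" unfolding J_def by (rule inj_on_nth_prime)
    show "nth_prime j < q" if "j \<in> J" for j
      using le_y[OF that] y_le_s s L_q by linarith
    show "d < N" using H by (simp add: N_def)
    show "3 * \<eta> < \<delta> j" if "j \<in> J" for j using half[OF that] \<delta>[OF that] by linarith
    have "l + 1 \<le> L" using ln_le_minus_one[of L] large by (simp add: l_def)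
    hence "(l + 1) * s \<le> L * L" using large s by (intro mult_mono) auto
    hence "(l + 1) * s / L\<^sup>2 \<le> 1" using large by (simp add: power2_eq_square)
    thus "\<kappa> \<le> 1" using kappa by linarith
  qed (use q prime_nth_prime prod_small a eta kappa \<delta> in \<open>simp_all add: J_def\<close>)
  have "character_count q y I = card box"
    unfolding character_count_def box_def J_def[symmetric] using I_eq by (intro arg_cong[of _ _ card]) auto
  moreover have "M = real (q - 1) * (\<Prod>j\<in>J. \<delta> j)"
    using q by (simp add: M_def J_def totient_prime)
  moreover note card_box_ratio[OF e0 _ small_eta[unfolded k_def] small_kappa[unfolded k_def]]
  ultimately show "(1 - e)\<^sup>2 \<le> real (character_count q y I) / M"
    and "real (character_count q y I) / M \<le> exp e / (1 - e)"
    using large by simp_all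
qed

theorem theorem9p3:
  shows "\<forall>\<epsilon>>0. \<exists>Q::nat. \<forall>q\<ge>Q. prime q \<longrightarrow>
    (\<forall>(y::real) (I :: nat \<Rightarrow> real set) (\<delta> :: nat \<Rightarrow> real).
       y > 2 \<longrightarrow>
       y \<le> sqrt (ln (real q)) / (ln (ln (real q)))\<^sup>2 \<longrightarrow>
       (\<forall>j\<in>{1..prime_count y}.
          open_interval_of_length (I j) (\<delta> j) \<and> I j \<subseteq> {0<..<1} \<and>
          \<delta> j > ln (ln (real q)) powr (-5/3)) \<longrightarrow>
       \<bar>real (character_count q y I) /
          (real (totient q) * (\<Prod>j\<in>{1..prime_count y}. \<delta> j)) - 1\<bar> < (\<epsilon>::real))"
proof (intro allI impI)
  fix \<epsilon> :: real assume \<epsilon>: "\<epsilon> > 0"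
  \<comment> \<open>The error depends on \<open>q\<close> alone, so one threshold \<open>Q\<close>
    serves all \<open>y\<close>, intervals and lengths at once; both bounds for the ratio tend to
    1.\<close>
  define e where "e = (\<lambda>q::nat. 12 * ln (ln (real q)) powr (-1/3))"
  have "((\<lambda>q. exp (e q) / (1 - e q)) \<longlongrightarrow> 1) sequentially"
    unfolding e_def by real_asymp
  hence up: "eventually (\<lambda>q. exp (e q) / (1 - e q) < 1 + \<epsilon>) sequentially"
    using \<epsilon> by (intro order_tendstoD(2)) auto
  have "((\<lambda>q. (1 - e q)\<^sup>2) \<longlongrightarrow> 1) sequentially"
    unfolding e_def by real_asymp
  hence lo: "eventually (\<lambda>q. 1 - \<epsilon> < (1 - e q)\<^sup>2) sequentially"
    using \<epsilon> by (intro order_tendstoD(1)) auto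
  have "eventually (\<lambda>q::nat. 64 \<le> ln (real q)) sequentially"
    "eventually (\<lambda>q::nat. 2 \<le> ln (ln (real q))) sequentially"
    "eventually (\<lambda>q. e q \<le> 1/2) sequentially"
    "eventually (\<lambda>q. 4 * ln (ln (real q)) \<le> e q * ln (real q)) sequentially"
    unfolding e_def by real_asymp+
  with up lo have "eventually (\<lambda>q. exp (e q) / (1 - e q) < 1 + \<epsilon> \<and> 1 - \<epsilon> < (1 - e q)\<^sup>2 \<and>
      64 \<le> ln (real q) \<and> 2 \<le> ln (ln (real q)) \<and> e q \<le> 1/2 \<and>
      4 * ln (ln (real q)) \<le> e q * ln (real q)) sequentially"
    by (intro eventually_conj)
  then obtain Q where Q: "\<And>q. q \<ge> Q \<Longrightarrow> exp (e q) / (1 - e q) < 1 + \<epsilon> \<and> 1 - \<epsilon> < (1 - e q)\<^sup>2 \<and>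
      64 \<le> ln (real q) \<and> 2 \<le> ln (ln (real q)) \<and> e q \<le> 1/2 \<and>
      4 * ln (ln (real q)) \<le> e q * ln (real q)"
    unfolding eventually_sequentially by blast
  show "\<exists>Q::nat. \<forall>q\<ge>Q. prime q \<longrightarrow>
    (\<forall>(y::real) (I :: nat \<Rightarrow> real set) (\<delta> :: nat \<Rightarrow> real).
       y > 2 \<longrightarrow>
       y \<le> sqrt (ln (real q)) / (ln (ln (real q)))\<^sup>2 \<longrightarrow>
       (\<forall>j\<in>{1..prime_count y}.
          open_interval_of_length (I j) (\<delta> j) \<and> I j \<subseteq> {0<..<1} \<and>
          \<delta> j > ln (ln (real q)) powr (-5/3)) \<longrightarrow>
       \<bar>real (character_count q y I) /
          (real (totient q) * (\<Prod>j\<in>{1..prime_count y}. \<delta> j)) - 1\<bar> < \<epsilon>)"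
  proof (intro exI[of _ Q] allI impI)
    fix q y I \<delta>
    assume q: "q \<ge> Q" "prime q" and y: "2 < y" "y \<le> sqrt (ln (real q)) / (ln (ln (real q)))\<^sup>2"
      and I: "\<forall>j\<in>{1..prime_count y}.
          open_interval_of_length (I j) (\<delta> j) \<and> I j \<subseteq> {0<..<1} \<and>
          \<delta> j > ln (ln (real q)) powr (-5/3)"
    note Q' = Q[OF q(1), unfolded e_def]
    have "(1 - e q)\<^sup>2 \<le> real (character_count q y I) /
          (real (totient q) * (\<Prod>j\<in>{1..prime_count y}. \<delta> j))"
      unfolding e_def by (rule character_count_ratio(1)[OF q(2) _ _ _ _ y]) (use Q' I in auto)
    moreover have "real (character_count q y I) /
          (real (totient q) * (\<Prod>j\<in>{1..prime_count y}. \<delta> j)) \<le> exp (e q) / (1 - e q)"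
      unfolding e_def by (rule character_count_ratio(2)[OF q(2) _ _ _ _ y]) (use Q' I in auto)
    ultimately show "\<bar>real (character_count q y I) /
          (real (totient q) * (\<Prod>j\<in>{1..prime_count y}. \<delta> j)) - 1\<bar> < \<epsilon>"
      using Q[OF q(1)] by linarith
  qed
qed

end
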